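(* Let $a>0$ and $\alpha\in\mathbb{F}_a$. Then the distribution $\mu_\alpha$ of the mean of a Dirichlet process with parameter $\alpha$ is symmetric if and only if $\alpha$ is symmetric.
   Context: For $a>0$, $\mathbb{F}_a$ is the set of finite measures $\alpha$ on $(\mathbb{R},\mathscr{B}(\mathbb{R}))$ with $\alpha(\mathbb{R})=a$ and $\int_{\mathbb{R}}\log(1+|x|)\,\alpha(dx)<+\infty$. A random probability measure $\tilde\varphi$ on $\mathbb{R}$ is a Dirichlet process with parameter $\alpha$ (law $\mathscr{D}_\alpha$) if, for every finite measurable partition $C_1,\ldots,C_{n+1}$ of $\mathbb{R}$, $(\tilde\varphi(C_1),\ldots,\tilde\varphi(C_n))$ has the Dirichlet distribution with parameter $(\alpha(C_1),\ldots,\alpha(C_{n+1}))$ (components with $\alpha(C_i)=0$ being a.s. $0$). For $\alpha\in\mathbb{F}_a$, $\int|x|\,\tilde\varphi(dx)<\infty$ a.s., and $\mu_\alpha$ is the probability distribution of the mean $\tilde\varphi(I)=\int x\,\tilde\varphi(dx)$ under $\mathscr{D}_\alpha$. A measure $\nu$ on $\mathbb{R}$ is symmetric if $\nu(B)=\nu(-B)$ for every Borel set $B$ (symmetry about $0$). *)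

theory Defs
  imports "HOL-Probability.Probability"
begin

definition measures_F :: "real \<Rightarrow> real measure set" where
  "measures_F a = {\<alpha>. sets \<alpha> = sets borel \<and> finite_measure \<alpha> \<and> measure \<alpha> UNIV = a \<and>
     (\<integral>\<^sup>+x. ennreal (ln (1 + \<bar>x\<bar>)) \<partial>\<alpha>) < \<infinity>}"

definition symmetric_measure :: "real measure \<Rightarrow> bool" where
  "symmetric_measure \<nu> \<longleftrightarrow> (\<forall>B\<in>sets borel. emeasure \<nu> B = emeasure \<nu> (uminus ` B))"

text \<open>
  Density of the Dirichlet distribution with positive parameters \<open>p i\<close>, \<open>i \<in> P\<close>, with respect to
  Lebesgue measure in the coordinates \<open>P - {j}\<close>; the coordinate \<open>j\<close> is \<open>1\<close> minus the sum of the
  others.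
\<close>

definition dirichlet_density :: "nat set \<Rightarrow> nat \<Rightarrow> (nat \<Rightarrow> real) \<Rightarrow> (nat \<Rightarrow> real) \<Rightarrow> real" where
  "dirichlet_density P j p x =
     (if (\<forall>i\<in>P - {j}. 0 < x i) \<and> (\<Sum>i\<in>P - {j}. x i) < 1
      then Gamma (\<Sum>i\<in>P. p i) / (\<Prod>i\<in>P. Gamma (p i)) *
           (\<Prod>i\<in>P - {j}. x i powr (p i - 1)) * (1 - (\<Sum>i\<in>P - {j}. x i)) powr (p j - 1)
      else 0)"

text \<open>
  The Dirichlet distribution on \<open>\<real>\<^sup>n\<close> with the \<open>n + 1\<close> nonnegative parameters \<open>p 0, \<dots>, p n\<close>, not
  all zero. Components with parameter zero are zero; the other ones have the usual density, where
  the redundant coordinate is the last one with positive parameter. See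
  \<open>dirichlet_positive\<close> for the case of positive parameters.
\<close>

definition dirichlet :: "nat \<Rightarrow> (nat \<Rightarrow> real) \<Rightarrow> (nat \<Rightarrow> real) measure" where
  "dirichlet n p =
     (let P = {i. i \<le> n \<and> 0 < p i}; j = Max P in
      distr (density (\<Pi>\<^sub>M i\<in>P - {j}. lborel) (\<lambda>x. ennreal (dirichlet_density P j p x)))
        (\<Pi>\<^sub>M i\<in>{..<n}. borel)
        (\<lambda>x. \<lambda>i\<in>{..<n}. if i = j then 1 - (\<Sum>k\<in>P - {j}. x k)
                       else if i \<in> P then x i else 0))"

lemma dirichlet_positive:
  assumes "\<And>i. i \<le> n \<Longrightarrow> 0 < p i"
  shows "dirichlet n p =
    density (\<Pi>\<^sub>M i\<in>{..<n}. lborel) (\<lambda>x. ennreal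
      (if (\<forall>i<n. 0 < x i) \<and> (\<Sum>i<n. x i) < 1
       then Gamma (\<Sum>i\<le>n. p i) / (\<Prod>i\<le>n. Gamma (p i)) *
            (\<Prod>i<n. x i powr (p i - 1)) * (1 - (\<Sum>i<n. x i)) powr (p n - 1)
       else 0))"
proof -
  have P: "{i. i \<le> n \<and> 0 < p i} = {..n}" using assms by auto
  have M: "Max {..n} = n" by (rule Max_eqI) auto
  have D: "{..n} - {n} = {..<n}" by auto
  let ?N = "density (\<Pi>\<^sub>M i\<in>{..<n}. lborel) (\<lambda>x. ennreal (dirichlet_density {..n} n p x))"
  have "dirichlet n p = distr ?N (\<Pi>\<^sub>M i\<in>{..<n}. borel)
      (\<lambda>x. \<lambda>i\<in>{..<n}. if i = n then 1 - (\<Sum>k<n. x k) else if i \<in> {..n} then x i else 0)"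
    by (simp only: dirichlet_def P M D Let_def)
  also have "\<dots> = distr ?N ?N (\<lambda>x. x)"
  proof (rule distr_cong)
    show "sets (\<Pi>\<^sub>M i\<in>{..<n}. borel) = sets ?N"
      by (simp add: sets_PiM_cong[OF refl sets_lborel])
    fix x assume "x \<in> space ?N"
    then show "(\<lambda>i\<in>{..<n}. if i = n then 1 - (\<Sum>k<n. x k) else if i \<in> {..n} then x i else 0) = x"
      by (auto simp: space_PiM PiE_def extensional_def fun_eq_iff restrict_def)
  qed simp
  also have "\<dots> = ?N" by (rule distr_id)
  finally show ?thesis
    unfolding dirichlet_density_def D by (simp only: Ball_def lessThan_iff)
qed

definition dirichlet_process ::
    "'w measure \<Rightarrow> ('w \<Rightarrow> real measure) \<Rightarrow> real measure \<Rightarrow> bool" where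
  "dirichlet_process M \<phi> \<alpha> \<longleftrightarrow>
     prob_space M \<and> \<phi> \<in> measurable M (prob_algebra borel) \<and>
     (\<forall>n C. (\<forall>i\<le>n. C i \<in> sets borel) \<and> disjoint_family_on C {..n} \<and> (\<Union>i\<le>n. C i) = UNIV \<longrightarrow>
        distr M (\<Pi>\<^sub>M i\<in>{..<n}. borel) (\<lambda>\<omega>. \<lambda>i\<in>{..<n}. measure (\<phi> \<omega>) (C i)) =
        dirichlet n (\<lambda>i. measure \<alpha> (C i)))"

definition mean_distribution :: "'w measure \<Rightarrow> ('w \<Rightarrow> real measure) \<Rightarrow> real measure" where
  "mean_distribution M \<phi> = distr M borel (\<lambda>\<omega>. \<integral>x. x \<partial>(\<phi> \<omega>))"

end

theory Submission
  imports Defs "HOL-Complex_Analysis.Conformal_Mappings"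
begin

text \<open>
  Let \<open>X = \<integral>x d\<phi>\<close> be the mean and let \<open>s\<close> be an independent gamma variable with shape \<open>a\<close>. A
  Dirichlet vector multiplied by \<open>s\<close> has independent gamma coordinates
  (\<open>gamma_times_dirichlet\<close>), so \<open>s X\<close> is the integral of \<open>x\<close> with respect to a random measure with
  independent gamma distributed masses. For functions with finitely many values its Laplace
  transform is therefore a finite product of gamma Laplace transforms \<open>(1 + z)\<^sup>-\<^sup>p\<close>, and a passage to
  the limit yields the Cifarelli--Regazzini identity (\<open>mean_transform\<close>)
  \<open>E exp (\<i> t s X) = exp (- \<integral> Ln (1 - \<i> t x) d\<alpha>)\<close> for real \<open>t\<close>.

  The mean is symmetric if and only if the imaginary part of the left-hand side vanishes for all
  \<open>t > 0\<close>. Indeed symmetry means that the sine transform \<open>E sin (u X)\<close> vanishes; mixing a bounded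
  continuous function over a gamma distributed dilation is a Laplace transform in disguise, hence
  injective (\<open>laplace_uniqueness\<close>). The argument of the right-hand side is
  \<open>\<theta> t = \<integral> arctan (t x) d\<alpha>\<close>, so the mean is symmetric if and only if \<open>sin (\<theta> t) = 0\<close> for all \<open>t > 0\<close>.
  Since \<open>\<theta>\<close> is continuous and \<open>\<theta> 0 = 0\<close>, it then cannot leave the zero \<open>0\<close> of the sine, so the
  condition is \<open>\<theta> = 0\<close>.

  If \<open>\<alpha>\<close> is symmetric, \<open>\<theta>\<close> vanishes because \<open>arctan\<close> is odd. Conversely, differentiating \<open>\<theta> = 0\<close>
  gives \<open>\<integral> x / (1 + (t x)\<^sup>2) d\<alpha> = 0\<close>. Up to the factor \<open>t\<close> this is the mixture of the sine transform of \<open>\<alpha>\<close>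
  over an exponential (shape 1) dilation, so the same injectivity shows that the sine transform of \<open>\<alpha>\<close>
  is zero (\<open>integral_arctan_zero_imp_symmetric\<close>). Thus the uniqueness argument is used twice: with
  shape \<open>a\<close> for the law of the mean and with shape 1 for \<open>\<alpha>\<close>.
\<close>

section \<open>The gamma distribution and its Laplace transform\<close>

definition gamma_density :: "real \<Rightarrow> real \<Rightarrow> real" where
  "gamma_density p s = (if 0 < s then s powr (p - 1) * exp (- s) / Gamma p else 0)"

definition gamma_measure :: "real \<Rightarrow> real measure" where
  "gamma_measure p = density lborel (\<lambda>s. ennreal (gamma_density p s))"

lemma gamma_density_nonneg: "0 < p \<Longrightarrow> 0 \<le> gamma_density p s"
  by (auto simp: gamma_density_def intro!: divide_nonneg_pos Gamma_real_pos)

lemma borel_measurable_gamma_density [measurable]: "gamma_density p \<in> borel_measurable borel"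
  unfolding gamma_density_def [abs_def] by measurable

lemma sets_gamma_measure [measurable_cong, simp]: "sets (gamma_measure p) = sets borel"
  by (simp add: gamma_measure_def)

lemma space_gamma_measure [simp]: "space (gamma_measure p) = UNIV"
  by (simp add: gamma_measure_def)

text \<open>
  Substituting \<open>t = l s\<close> in Euler's integral. With \<open>l = 1 + c\<close> and shape \<open>p + k\<close> this gives all the
  exponential moments of the gamma distribution below.
\<close>

lemma nn_integral_gamma_scaled:
  fixes p l :: real
  assumes p: "0 < p" and l: "0 < l"
  shows "(\<integral>\<^sup>+ s. ennreal (indicator {0<..} s * s powr (p - 1) * exp (- (l * s))) \<partial>lborel)
           = ennreal (Gamma p / l powr p)"
proof -
  let ?f = "\<lambda>t::real. ennreal (indicator {0..} t * t powr (p - 1) / exp t)"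
  let ?I = "\<integral>\<^sup>+ s. ennreal (indicator {0<..} s * s powr (p - 1) * exp (- (l * s))) \<partial>lborel"
  have "ennreal (Gamma p) = integral\<^sup>N lborel ?f"
    using Gamma_conv_nn_integral_real [OF p] .
  also have "\<dots> = ennreal \<bar>l\<bar> * (\<integral>\<^sup>+ s. ?f (0 + l * s) \<partial>lborel)"
    using l by (intro nn_integral_real_affine) auto
  also have "(\<integral>\<^sup>+ s. ?f (0 + l * s) \<partial>lborel) =
      (\<integral>\<^sup>+ s. ennreal (l powr (p - 1)) *
         ennreal (indicator {0<..} s * s powr (p - 1) * exp (- (l * s))) \<partial>lborel)"
    using l
    by (intro nn_integral_cong)
       (auto simp: indicator_def powr_mult exp_minus field_simps zero_le_mult_iff
             simp flip: ennreal_mult' ennreal_mult'')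
  also have "\<dots> = ennreal (l powr (p - 1)) * ?I"
    by (rule nn_integral_cmult) measurable
  also have "ennreal \<bar>l\<bar> * (ennreal (l powr (p - 1)) * ?I) = ennreal (l powr p) * ?I"
    using l by (simp add: mult.assoc [symmetric] powr_mult_base flip: ennreal_mult')
  finally have "ennreal (Gamma p) = ennreal (l powr p) * ?I" .
  then have "ennreal (1 / l powr p) * ennreal (Gamma p)
       = (ennreal (1 / l powr p) * ennreal (l powr p)) * ?I"
    by (simp add: mult.assoc)
  also have "ennreal (1 / l powr p) * ennreal (l powr p) = 1"
    using l by (simp flip: ennreal_mult')
  finally show ?thesis
    using l p by (simp flip: ennreal_mult' add: Gamma_real_pos less_imp_le)
qed

lemma
  fixes p c :: real
  assumes p: "0 < p" and c: "-1 < c"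
  shows integrable_gamma_exp: "integrable (gamma_measure p) (\<lambda>s. s ^ k * exp (- (c * s)))"
    and integral_gamma_exp: "(\<integral>s. exp (- (c * s)) \<partial>gamma_measure p) = (1 + c) powr (- p)"
proof -
  have G: "Gamma p > 0" using p by (rule Gamma_real_pos)
  have *: "has_bochner_integral lborel (\<lambda>s. gamma_density p s *\<^sub>R (s ^ k * exp (- (c * s))))
      (Gamma (p + k) / (1 + c) powr (p + k) / Gamma p)" for k :: nat
  proof (rule has_bochner_integral_nn_integral)
    show "AE x in lborel. 0 \<le> gamma_density p x *\<^sub>R (x ^ k * exp (- (c * x)))"
      using gamma_density_nonneg [OF p] by (auto simp: gamma_density_def G less_imp_le)
    have "(\<integral>\<^sup>+ x. ennreal (gamma_density p x *\<^sub>R (x ^ k * exp (- (c * x)))) \<partial>lborel) =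
        (\<integral>\<^sup>+ x. ennreal (1 / Gamma p) * ennreal (indicator {0<..} x * x powr ((p + k) - 1)
            * exp (- ((1 + c) * x))) \<partial>lborel)"
    proof (intro nn_integral_cong)
      fix x :: real
      have "gamma_density p x *\<^sub>R (x ^ k * exp (- (c * x))) =
          1 / Gamma p * (indicator {0<..} x * x powr ((p + k) - 1) * exp (- ((1 + c) * x)))"
      proof (cases "0 < x")
        case True
        have 1: "x powr ((p + k) - 1) = x powr (p - 1) * x ^ k"
          using True by (simp add: powr_add powr_diff powr_realpow)
        have 2: "exp (- ((1 + c) * x)) = exp (- x) * exp (- (c * x))"
          by (simp add: algebra_simps flip: exp_add)
        show ?thesis unfolding 1 2 using True by (simp add: gamma_density_def)
      qed (simp add: gamma_density_def)
      with G show "ennreal (gamma_density p x *\<^sub>R (x ^ k * exp (- (c * x)))) =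
          ennreal (1 / Gamma p) * ennreal (indicator {0<..} x * x powr ((p + k) - 1)
            * exp (- ((1 + c) * x)))"
        by (simp only: ennreal_mult' divide_nonneg_pos zero_le_one)
    qed
    also have "\<dots> = ennreal (1 / Gamma p) * ennreal (Gamma (p + k) / (1 + c) powr (p + k))"
      using p c by (subst nn_integral_cmult) (auto simp: nn_integral_gamma_scaled)
    also have "\<dots> = ennreal (Gamma (p + k) / (1 + c) powr (p + k) / Gamma p)"
      using G by (simp add: mult.commute flip: ennreal_mult')
    finally show "(\<integral>\<^sup>+ x. ennreal (gamma_density p x *\<^sub>R (x ^ k * exp (- (c * x)))) \<partial>lborel) =
        ennreal (Gamma (p + k) / (1 + c) powr (p + k) / Gamma p)" .
    show "0 \<le> Gamma (p + real k) / (1 + c) powr (p + real k) / Gamma p"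
      using p G Gamma_real_pos [of "p + k"] by auto
  qed measurable
  show "integrable (gamma_measure p) (\<lambda>s. s ^ k * exp (- (c * s)))"
    unfolding gamma_measure_def
    using * [of k] gamma_density_nonneg [OF p]
    by (subst integrable_density) (auto simp: has_bochner_integral_iff)
  show "(\<integral>s. exp (- (c * s)) \<partial>gamma_measure p) = (1 + c) powr (- p)"
    unfolding gamma_measure_def
    using * [of 0] gamma_density_nonneg [OF p] G
    by (subst integral_density) (auto simp: has_bochner_integral_iff powr_minus field_simps)
qed

lemma prob_space_gamma_measure:
  assumes "0 < p"
  shows "prob_space (gamma_measure p)"
proof -
  interpret finite_measure "gamma_measure p"
    using integrable_gamma_exp [OF assms, of 0 0]
    by (intro finite_measureI) (auto simp: integrable_iff_bounded)
  have "measure (gamma_measure p) UNIV = 1"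
    using integral_gamma_exp [OF assms, of 0] by simp
  then show ?thesis
    by (auto intro!: prob_spaceI simp: emeasure_eq_measure)
qed

lemma AE_gamma_measure_pos: "AE s in gamma_measure p. 0 < s"
  unfolding gamma_measure_def by (subst AE_density) (auto simp: gamma_density_def)

lemma integrable_gamma_cexp:
  assumes p: "0 < p" and z: "-1 < Re z"
  shows "integrable (gamma_measure p) (\<lambda>s. of_real s ^ k * exp (- (z * of_real s)) :: complex)"
  using integrable_gamma_exp [OF p z, of k]
  by (rule Bochner_Integration.integrable_bound)
     (use AE_gamma_measure_pos [of p] in \<open>auto simp: norm_mult norm_power norm_exp_eq_Re elim!: eventually_mono\<close>)

text \<open>
  Differentiation under the integral sign. The remainder in the Taylor expansion of \<open>exp (- h s)\<close> is
  at most \<open>\<bar>h\<bar>\<^sup>2 s\<^sup>2 exp (\<bar>Re h\<bar> s)\<close>, which is integrable uniformly in \<open>h\<close> as long as \<open>\<bar>h\<bar>\<close> stays below half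
  of the distance from \<open>z\<close> to the line \<open>Re z = -1\<close>.
\<close>

lemma gamma_laplace_has_derivative:
  fixes z :: complex
  assumes p: "0 < p" and z: "-1 < Re z"
  shows "((\<lambda>z. \<integral>s. exp (- (z * of_real s)) \<partial>gamma_measure p) has_field_derivative
      - (\<integral>s. of_real s * exp (- (z * of_real s)) \<partial>gamma_measure p)) (at z)"
proof -
  let ?G = "gamma_measure p"
  define F where "F z = (\<integral>s. exp (- (z * of_real s)) \<partial>?G)" for z :: complex
  define D where "D = - (\<integral>s. of_real s * exp (- (z * of_real s)) \<partial>?G)"
  define \<delta> where "\<delta> = (1 + Re z) / 2"
  have \<delta>: "0 < \<delta>" "-1 < Re z - \<delta>" using z by (auto simp: \<delta>_def field_simps)
  define C where "C = (\<integral>s. s ^ 2 * exp (- ((Re z - \<delta>) * s)) \<partial>?G)"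
  have bound: "norm (F (z + h) - F z - h * D) \<le> C * (norm h)\<^sup>2" if h: "norm h < \<delta>" for h
  proof -
    have Re: "\<bar>Re h\<bar> < \<delta>" using abs_Re_le_cmod [of h] h by linarith
    have i1: "integrable ?G (\<lambda>s. exp (- ((z + h) * of_real s)))"
      using integrable_gamma_cexp [OF p, of "z + h" 0] Re \<delta> by simp
    have i2: "integrable ?G (\<lambda>s. exp (- (z * of_real s)))"
      using integrable_gamma_cexp [OF p z, of 0] by simp
    have i3: "integrable ?G (\<lambda>s. of_real s * exp (- (z * of_real s)) :: complex)"
      using integrable_gamma_cexp [OF p z, of 1] by simp
    have "F (z + h) - F z - h * D = (\<integral>s. exp (- ((z + h) * of_real s)) - exp (- (z * of_real s))
        + h * (of_real s * exp (- (z * of_real s))) \<partial>?G)"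
      unfolding F_def D_def using i1 i2 i3 by simp
    also have "norm \<dots> \<le> (\<integral>s. (norm h)\<^sup>2 * (s ^ 2 * exp (- ((Re z - \<delta>) * s))) \<partial>?G)"
    proof (rule order_trans [OF integral_norm_bound integral_mono_AE])
      show "integrable ?G (\<lambda>s. norm (exp (- ((z + h) * of_real s)) - exp (- (z * of_real s))
        + h * (of_real s * exp (- (z * of_real s)))))"
        using i1 i2 i3 by simp
      show "integrable ?G (\<lambda>s. (norm h)\<^sup>2 * (s ^ 2 * exp (- ((Re z - \<delta>) * s))))"
        using integrable_gamma_exp [OF p \<delta>(2)] by simp
      have "norm (exp (- ((z + h) * of_real s)) - exp (- (z * of_real s))
          + h * (of_real s * exp (- (z * of_real s))))
          \<le> (norm h)\<^sup>2 * (s ^ 2 * exp (- ((Re z - \<delta>) * s)))" if s: "0 < s" for s :: real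
      proof -
        let ?w = "- (h * of_real s)"
        have "exp (- ((z + h) * of_real s)) - exp (- (z * of_real s))
          + h * (of_real s * exp (- (z * of_real s))) = exp (- (z * of_real s)) * (exp ?w - (1 + ?w))"
          by (simp add: algebra_simps exp_add exp_diff exp_minus field_simps)
        also have "norm \<dots> \<le> exp (- (Re z * s)) * (exp \<bar>Re ?w\<bar> * norm ?w ^ 2)"
          using Taylor_exp [of ?w 1]
          by (simp add: norm_mult numeral_2_eq_2)
        also have "\<dots> \<le> exp (- (Re z * s)) * (exp (\<delta> * s) * norm ?w ^ 2)"
          using Re s by (intro mult_left_mono mult_right_mono) (auto simp: abs_mult)
        also have "exp (- (Re z * s)) * (exp (\<delta> * s) * norm ?w ^ 2)
            = (norm h)\<^sup>2 * (s ^ 2 * exp (- ((Re z - \<delta>) * s)))"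
          by (simp add: norm_mult power_mult_distrib exp_diff algebra_simps exp_minus field_simps)
        finally show ?thesis by simp
      qed
      then show "AE s in ?G. norm (exp (- ((z + h) * of_real s)) - exp (- (z * of_real s))
          + h * (of_real s * exp (- (z * of_real s))))
          \<le> (norm h)\<^sup>2 * (s ^ 2 * exp (- ((Re z - \<delta>) * s)))"
        by (rule eventually_mono [OF AE_gamma_measure_pos [of p]])
    qed
    also have "\<dots> = C * (norm h)\<^sup>2" by (simp add: C_def)
    finally show ?thesis .
  qed
  have "(F has_field_derivative D) (at z)"
    unfolding has_field_derivative_def has_derivative_at
  proof (intro conjI)
    show "bounded_linear ((*) D)" by (rule bounded_linear_mult_right)
    show "(\<lambda>h. norm (F (z + h) - F z - D * h) / norm h) \<midarrow>0\<rightarrow> 0"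
    proof (rule Lim_null_comparison)
      show "\<forall>\<^sub>F h in at 0. norm (norm (F (z + h) - F z - D * h) / norm h) \<le> C * norm h"
        unfolding eventually_at
        using \<delta>(1) bound
        by (intro exI [of _ \<delta>]) (auto simp: divide_le_eq power2_eq_square mult.commute mult.left_commute)
      show "(\<lambda>h. C * norm h) \<midarrow>0\<rightarrow> 0"
        by (intro tendsto_mult_right_zero tendsto_norm_zero tendsto_ident_at)
    qed
  qed
  then show ?thesis unfolding F_def D_def .
qed

text \<open>
  For real \<open>z\<close> this is a real integral; both sides are holomorphic in the half plane, so they agree
  everywhere by analytic continuation from the interval \<open>(0, 1)\<close>.
\<close>

lemma gamma_laplace:
  fixes z :: complex
  assumes p: "0 < p" and z: "-1 < Re z"
  shows "(\<integral>s. exp (- (z * of_real s)) \<partial>gamma_measure p) = exp (- of_real p * Ln (1 + z))"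
proof -
  let ?S = "{w. -1 < Re w}"
  let ?F = "\<lambda>z. \<integral>s. exp (- (z * of_real s)) \<partial>gamma_measure p"
  let ?U = "of_real ` {0<..<1} :: complex set"
  have conn: "connected ?S" "open ?S"
    using convex_halfspace_Re_gt [of "-1"] open_halfspace_Re_gt [of "-1"]
    by (auto intro: convex_connected)
  have "?F z - exp (- of_real p * Ln (1 + z)) = 0"
  proof (rule analytic_continuation [of "\<lambda>z. ?F z - exp (- of_real p * Ln (1 + z))" ?S ?U 0])
    show "(\<lambda>z. ?F z - exp (- of_real p * Ln (1 + z))) holomorphic_on ?S"
    proof (intro holomorphic_intros)
      show "?F holomorphic_on ?S"
      proof (rule holomorphic_onI, rule field_differentiable_at_within)
        fix w :: complex assume "w \<in> ?S"
        then have "-1 < Re w" by simp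
        from gamma_laplace_has_derivative [OF p this] show "?F field_differentiable at w"
          unfolding field_differentiable_def by blast
      qed
      fix w :: complex assume "w \<in> ?S"
      then show "1 + w \<notin> \<real>\<^sub>\<le>\<^sub>0" by (auto simp: complex_nonpos_Reals_iff)
    qed
    show "0 islimpt ?U"
      unfolding islimpt_approachable
    proof (intro allI impI)
      fix e :: real assume "0 < e"
      then show "\<exists>x'\<in>?U. x' \<noteq> 0 \<and> dist x' 0 < e"
        by (intro bexI [of _ "of_real (min (e/2) (1/2))"]) auto
    qed
    fix w assume "w \<in> ?U"
    then obtain c where c: "w = of_real c" "0 < c" by auto
    have "?F w = (\<integral>s. of_real (exp (- (c * s))) \<partial>gamma_measure p)"
      by (simp add: c flip: of_real_mult of_real_minus exp_of_real)
    also have "\<dots> = of_real ((1 + c) powr (- p))"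
      using integral_gamma_exp [OF p, of c] c by simp
    also have "\<dots> = exp (- of_real p * Ln (1 + w))"
    proof -
      have "1 + w = of_real (1 + c)" by (simp add: c)
      then have "Ln (1 + w) = of_real (ln (1 + c))"
        using c by (simp only: Ln_of_real add_pos_pos zero_less_one)
      then show ?thesis using c by (simp add: powr_def flip: exp_of_real)
    qed
    finally show "?F w - exp (- of_real p * Ln (1 + w)) = 0" by simp
  qed (use conn z in auto)
  then show ?thesis by simp
qed

section \<open>Uniqueness for Laplace transforms\<close>

text \<open>
  The dilations by \<open>t = 1 / (k + 1)\<close> already suffice: after rescaling they say that \<open>h\<close> is orthogonal
  to all powers of \<open>w = exp (- u)\<close>. The function \<open>h u * exp (- u)\<close> is continuous in \<open>w\<close> on \<open>[0, 1]\<close>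
  because \<open>h\<close> is bounded, so by Weierstrass it is a uniform limit of polynomials in \<open>w\<close>. Hence \<open>h\<close>
  is orthogonal to it, that is, the integral of \<open>(h u)\<^sup>2 exp (- u)\<close> is zero.
\<close>

lemma laplace_uniqueness:
  fixes h :: "real \<Rightarrow> real"
  assumes b: "0 < b" and cont: "continuous_on UNIV h" and bounded: "\<And>u. \<bar>h u\<bar> \<le> B"
    and zero: "\<And>t. 0 < t \<Longrightarrow> (\<integral>s. h (t * s) \<partial>gamma_measure b) = 0"
    and u: "0 < u"
  shows "h u = 0"
proof -
  let ?G = "gamma_measure b"
  interpret prob_space ?G using b by (rule prob_space_gamma_measure)
  have [measurable]: "h \<in> borel_measurable borel"
    using cont by (rule borel_measurable_continuous_onI)
  have B: "0 \<le> B" using bounded [of 0] by simp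
  have int: "integrable ?G (\<lambda>u. h u * exp (- u) ^ k)" for k :: nat
  proof (rule integrable_const_bound [where B = B])
    show "AE u in ?G. norm (h u * exp (- u) ^ k) \<le> B"
      using AE_gamma_measure_pos
    proof eventually_elim
      case (elim u)
      have "\<bar>h u\<bar> * exp (- u) ^ k \<le> B * 1"
        using elim bounded [of u] B by (intro mult_mono power_le_one) auto
      then show ?case by (simp add: abs_mult)
    qed
  qed measurable
  have moment: "(\<integral>u. h u * exp (- u) ^ k \<partial>?G) = 0" for k :: nat
  proof -
    let ?c = "real k + 1"
    have "0 = (\<integral>s. h (1 / ?c * s) \<partial>?G)"
      by (rule zero [symmetric]) simp
    also have "\<dots> = (\<integral>s. gamma_density b s * h (1 / ?c * s) \<partial>lborel)"
      unfolding gamma_measure_def using gamma_density_nonneg [OF b]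
      by (subst integral_density) auto
    also have "\<dots> = \<bar>?c\<bar> *\<^sub>R (\<integral>u. gamma_density b (0 + ?c * u) * h (1 / ?c * (0 + ?c * u)) \<partial>lborel)"
      by (rule lborel_integral_real_affine) simp
    also have "(\<integral>u. gamma_density b (0 + ?c * u) * h (1 / ?c * (0 + ?c * u)) \<partial>lborel) =
        (\<integral>u. ?c powr (b - 1) * (gamma_density b u * (h u * exp (- u) ^ k)) \<partial>lborel)"
    proof (rule Bochner_Integration.integral_cong [OF refl])
      fix u :: real
      have c0: "0 < ?c" by simp
      have 1: "1 / ?c * (0 + ?c * u) = u" using c0 by (simp del: of_nat_Suc)
      have 2: "exp (- (?c * u)) = exp (- u) * exp (- u) ^ k"
        by (simp add: algebra_simps flip: exp_of_nat_mult exp_add)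
      have "0 < ?c * u \<longleftrightarrow> 0 < u" using c0 by (simp add: zero_less_mult_iff)
      moreover have "(?c * u) powr (b - 1) = ?c powr (b - 1) * u powr (b - 1)" if "0 < u"
        by (rule powr_mult)
      ultimately show "gamma_density b (0 + ?c * u) * h (1 / ?c * (0 + ?c * u)) =
          ?c powr (b - 1) * (gamma_density b u * (h u * exp (- u) ^ k))"
        unfolding 1 gamma_density_def add_0_left 2 by (auto simp: 2)
    qed
    also have "\<dots> = ?c powr (b - 1) * (\<integral>u. h u * exp (- u) ^ k \<partial>?G)"
      unfolding gamma_measure_def using gamma_density_nonneg [OF b]
      by (subst integral_density) auto
    finally show ?thesis by (simp add: add_eq_0_iff_both_eq_0)
  qed
  \<comment> \<open>The function \<open>h u * exp (- u)\<close> in the variable \<open>w = exp (- u)\<close>; the value at \<open>w = 0\<close> is \<open>0\<close>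
    through the factor \<open>w\<close>, whatever \<open>ln 0\<close> is.\<close>
  define g where "g w = h (- ln w) * w" for w :: real
  have contg: "continuous_on {0..1} g"
    unfolding continuous_on_eq_continuous_within
  proof
    fix w :: real assume w: "w \<in> {0..1}"
    show "continuous (at w within {0..1}) g"
    proof (cases "w = 0")
      case True
      have "(g \<longlongrightarrow> 0) (at 0 within {0..1})"
      proof (rule Lim_null_comparison)
        show "\<forall>\<^sub>F w in at 0 within {0..1}. norm (g w) \<le> B * \<bar>w\<bar>"
          using bounded by (intro always_eventually) (auto simp: g_def abs_mult intro: mult_right_mono)
        show "((\<lambda>w. B * \<bar>w\<bar>) \<longlongrightarrow> 0) (at 0 within {0..1})"
          by (rule tendsto_eq_intros | simp)+
      qed
      then show ?thesis using True by (simp add: continuous_within g_def)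
    next
      case False
      have "isCont h (- ln w)" using cont by (simp add: continuous_on_eq_continuous_at)
      moreover have "isCont (\<lambda>w. - ln w) w" using False by (intro continuous_intros) auto
      ultimately have "isCont (\<lambda>w. h (- ln w)) w"
        by (rule isCont_o2 [rotated])
      then have "isCont g w" unfolding g_def [abs_def] by (intro continuous_intros)
      then show ?thesis by (rule continuous_at_imp_continuous_at_within)
    qed
  qed
  have int2: "integrable ?G (\<lambda>u. (h u)\<^sup>2 * exp (- u))"
  proof (rule integrable_const_bound [where B = "B\<^sup>2"])
    show "AE u in ?G. norm ((h u)\<^sup>2 * exp (- u)) \<le> B\<^sup>2"
      using AE_gamma_measure_pos
    proof eventually_elim
      case (elim u)
      have "(h u)\<^sup>2 \<le> B\<^sup>2" using abs_le_square_iff [of "h u" B] bounded [of u] B by simp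
      then have "(h u)\<^sup>2 * exp (- u) \<le> B\<^sup>2 * 1"
        using elim by (intro mult_mono) auto
      then show ?case by simp
    qed
  qed measurable
  have small: "(\<integral>u. (h u)\<^sup>2 * exp (- u) \<partial>?G) \<le> B * e" if e: "0 < e" for e
  proof -
    obtain q where q: "real_polynomial_function q" "\<And>w. w \<in> {0..1} \<Longrightarrow> \<bar>g w - q w\<bar> < e"
      using Stone_Weierstrass_real_polynomial_function [OF compact_Icc contg e] by metis
    obtain a n where a: "q = (\<lambda>w. \<Sum>i\<le>n. a i * w ^ i)"
      using q(1) unfolding real_polynomial_function_iff_sum by blast
    have eq: "h u * q (exp (- u)) = (\<Sum>i\<le>n. a i * (h u * exp (- u) ^ i))" for u
      unfolding a sum_distrib_left by (intro sum.cong) auto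
    have q0: "integrable ?G (\<lambda>u. h u * q (exp (- u)))" "(\<integral>u. h u * q (exp (- u)) \<partial>?G) = 0"
      unfolding eq using int by (auto simp: moment)
    have "(\<integral>u. (h u)\<^sup>2 * exp (- u) \<partial>?G) = (\<integral>u. (h u)\<^sup>2 * exp (- u) - h u * q (exp (- u)) \<partial>?G)"
      using int2 q0 by simp
    also have "\<dots> \<le> (\<integral>u. B * e \<partial>?G)"
    proof (rule integral_mono_AE)
      show "AE u in ?G. (h u)\<^sup>2 * exp (- u) - h u * q (exp (- u)) \<le> B * e"
        using AE_gamma_measure_pos
      proof eventually_elim
        case (elim u)
        have "(h u)\<^sup>2 * exp (- u) - h u * q (exp (- u)) = h u * (g (exp (- u)) - q (exp (- u)))"
          by (simp add: g_def algebra_simps power2_eq_square)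
        also have "\<dots> \<le> \<bar>h u\<bar> * \<bar>g (exp (- u)) - q (exp (- u))\<bar>"
          by (simp flip: abs_mult)
        also have "\<dots> \<le> B * e"
          using elim bounded [of u] q(2) [of "exp (- u)"] B by (intro mult_mono) auto
        finally show ?case .
      qed
    qed (use int2 q0 in simp_all)
    finally show ?thesis using prob_space by simp
  qed
  have "(\<integral>u. (h u)\<^sup>2 * exp (- u) \<partial>?G) \<le> 0"
  proof (rule field_le_epsilon)
    fix e :: real assume "0 < e"
    have "(\<integral>u. (h u)\<^sup>2 * exp (- u) \<partial>?G) \<le> B * (e / (B + 1))"
      using small [of "e / (B + 1)"] B \<open>0 < e\<close> by simp
    also have "\<dots> \<le> 0 + e" using B \<open>0 < e\<close> by (simp add: field_simps)
    finally show "(\<integral>u. (h u)\<^sup>2 * exp (- u) \<partial>?G) \<le> 0 + e" .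
  qed
  then have "(\<integral>u. (h u)\<^sup>2 * exp (- u) \<partial>?G) = 0"
    by (intro antisym integral_nonneg_AE) auto
  then have "AE u in ?G. (h u)\<^sup>2 * exp (- u) = 0"
    using integral_nonneg_eq_0_iff_AE [OF int2] by simp
  then have "AE u in lborel. 0 < u \<longrightarrow> h u = 0"
    unfolding gamma_measure_def using Gamma_real_pos [OF b]
    by (subst (asm) AE_density) (auto simp: gamma_density_def elim!: eventually_mono)
  then have "{u. 0 < u \<and> h u \<noteq> 0} \<in> null_sets lborel"
    by (subst AE_iff_null_sets) auto
  then have "negligible {u. 0 < u \<and> h u \<noteq> 0}"
    unfolding negligible_iff_null_sets by (rule null_sets_completionI)
  moreover have "open {u. 0 < u \<and> h u \<noteq> 0}"
    using cont by (intro open_Collect_conj open_Collect_less open_Collect_neq continuous_intros)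
  ultimately show ?thesis
    using open_not_negligible u by blast
qed

section \<open>Symmetry in terms of sine and arctangent integrals\<close>

lemma symmetric_measure_iff_distr:
  assumes [measurable_cong]: "sets \<nu> = sets borel"
  shows "symmetric_measure \<nu> \<longleftrightarrow> distr \<nu> borel uminus = \<nu>"
proof -
  have sp: "space \<nu> = UNIV" using sets_eq_imp_space_eq [OF assms] by simp
  have img: "uminus ` B = uminus -` B" for B :: "real set"
    by (auto simp: image_iff) (metis minus_minus)
  have "emeasure (distr \<nu> borel uminus) B = emeasure \<nu> (uminus ` B)" if "B \<in> sets borel" for B
    using that by (subst emeasure_distr) (auto simp: sp img)
  then show ?thesis
    unfolding symmetric_measure_def using assms
    by (metis measure_eqI sets_distr)
qed

definition sine_transform :: "real measure \<Rightarrow> real \<Rightarrow> real" where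
  "sine_transform \<nu> u = (\<integral>x. sin (u * x) \<partial>\<nu>)"

lemma continuous_sine_transform:
  assumes "finite_measure \<nu>" and [measurable_cong]: "sets \<nu> = sets borel"
  shows "continuous_on UNIV (sine_transform \<nu>)"
  unfolding continuous_on_eq_continuous_at [OF open_UNIV] continuous_at_sequentially
proof safe
  interpret finite_measure \<nu> by fact
  fix u :: real and X :: "nat \<Rightarrow> real" assume X: "X \<longlonglongrightarrow> u"
  have "(\<lambda>n. \<integral>x. sin (X n * x) \<partial>\<nu>) \<longlonglongrightarrow> (\<integral>x. sin (u * x) \<partial>\<nu>)"
  proof (rule integral_dominated_convergence [where w = "\<lambda>_. 1"])
    show "AE x in \<nu>. (\<lambda>n. sin (X n * x)) \<longlonglongrightarrow> sin (u * x)"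
      using X by (intro always_eventually allI tendsto_intros)
  qed auto
  then show "(sine_transform \<nu> \<circ> X) \<longlonglongrightarrow> sine_transform \<nu> u"
    by (simp add: sine_transform_def comp_def)
qed

lemma sine_transform_bounded:
  assumes "finite_measure \<nu>" and [measurable_cong]: "sets \<nu> = sets borel"
  shows "\<bar>sine_transform \<nu> u\<bar> \<le> measure \<nu> (space \<nu>)"
proof -
  interpret finite_measure \<nu> by fact
  have "\<bar>sine_transform \<nu> u\<bar> \<le> (\<integral>x. 1 \<partial>\<nu>)"
    unfolding sine_transform_def real_norm_def [symmetric]
  proof (rule order_trans [OF integral_norm_bound integral_mono])
    show "integrable \<nu> (\<lambda>x. norm (sin (u * x)))"
      by (rule integrable_const_bound [where B = 1]) auto
  qed auto
  then show ?thesis by simp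
qed

text \<open>
  The sine transform is the imaginary part of the characteristic function, so it vanishes exactly
  if the measure and its reflection have the same characteristic function. The uniqueness theorem
  of Levy concerns probability measures, hence the normalization of \<open>\<nu>\<close> in the proof.
\<close>

lemma symmetric_measure_iff_sine_transform:
  assumes "finite_measure \<nu>" and sets [measurable_cong]: "sets \<nu> = sets borel"
    and pos: "0 < measure \<nu> UNIV"
  shows "symmetric_measure \<nu> \<longleftrightarrow> (\<forall>u>0. sine_transform \<nu> u = 0)"
proof
  interpret finite_measure \<nu> by fact
  assume "symmetric_measure \<nu>"
  then have d: "distr \<nu> borel uminus = \<nu>" using symmetric_measure_iff_distr [OF sets] by simp
  show "\<forall>u>0. sine_transform \<nu> u = 0"
  proof safe
    fix u :: real
    have "sine_transform \<nu> u = (\<integral>x. sin (u * x) \<partial>distr \<nu> borel uminus)"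
      by (simp add: sine_transform_def d)
    also have "\<dots> = - sine_transform \<nu> u"
      by (subst integral_distr) (auto simp: sine_transform_def)
    finally show "sine_transform \<nu> u = 0" by simp
  qed
next
  interpret finite_measure \<nu> by fact
  have sp: "space \<nu> = UNIV" using sets_eq_imp_space_eq [OF sets] by simp
  assume zero: "\<forall>u>0. sine_transform \<nu> u = 0"
  define c where "c = measure \<nu> UNIV"
  define N where "N = density \<nu> (\<lambda>_. ennreal (1 / c))"
  have c: "0 < c" using pos by (simp add: c_def)
  have [simp, measurable_cong]: "sets N = sets borel" by (simp add: N_def sets)
  have spN: "space N = UNIV" by (simp add: N_def sp)
  have "emeasure N UNIV = 1"
    using c unfolding N_def
    by (subst emeasure_density_const) (auto simp: sets emeasure_eq_measure simp flip: ennreal_mult' c_def)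
  then interpret N: real_distribution N
    by (intro real_distribution.intro prob_spaceI real_distribution_axioms.intro) (auto simp: spN)
  let ?N = "distr N borel uminus"
  interpret N': real_distribution ?N
    by (intro real_distribution.intro N.prob_space_distr real_distribution_axioms.intro) auto
  have sin0: "sine_transform \<nu> u = 0" for u
  proof -
    have "sine_transform \<nu> (- u) = - sine_transform \<nu> u" by (simp add: sine_transform_def)
    then show ?thesis
      using zero [rule_format, of u] zero [rule_format, of "- u"]
      by (cases u "0::real" rule: linorder_cases) (auto simp: sine_transform_def [of _ 0])
  qed
  have intN: "integrable N (\<lambda>x. iexp (t * x))" for t
    by (rule N.integrable_const_bound [where B = 1]) auto
  have "Im (char N t) = 0" for t
  proof -
    have "Im (char N t) = (\<integral>x. Im (iexp (t * x)) \<partial>N)"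
      unfolding char_def using intN by (rule integral_Im [symmetric])
    also have "\<dots> = (\<integral>x. 1 / c * sin (t * x) \<partial>\<nu>)"
      unfolding N_def using c by (subst integral_density) (auto simp: Im_exp)
    also have "\<dots> = 1 / c * sine_transform \<nu> t"
      unfolding sine_transform_def by (rule integral_mult_right_zero)
    finally show ?thesis using sin0 by simp
  qed
  moreover have "char ?N t = cnj (char N t)" for t
  proof -
    have "char ?N t = (\<integral>x. cnj (iexp (t * x)) \<partial>N)"
      unfolding char_def by (subst integral_distr) (auto simp: exp_cnj)
    also have "\<dots> = cnj (char N t)"
      unfolding char_def by (rule Bochner_Integration.integral_cnj)
    finally show ?thesis .
  qed
  ultimately have "char ?N = char N"
    by (auto simp: fun_eq_iff complex_eq_iff)
  then have "?N = N"
    by (intro Levy_uniqueness N'.real_distribution_axioms N.real_distribution_axioms)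
  then have "symmetric_measure N" by (simp add: symmetric_measure_iff_distr)
  moreover have "emeasure \<nu> B = ennreal c * emeasure N B" if "B \<in> sets borel" for B
    unfolding N_def using that c
    by (subst emeasure_density_const) (auto simp: sets simp flip: ennreal_mult' mult.assoc)
  moreover have "uminus ` B \<in> sets borel" if "B \<in> sets borel" for B :: "real set"
  proof -
    have "uminus ` B = uminus -` B"
      by (auto simp: image_iff) (metis minus_minus)
    moreover have "uminus -` B \<inter> space borel \<in> sets borel"
      using that by (intro measurable_sets [where A = borel]) auto
    ultimately show ?thesis by simp
  qed
  ultimately show "symmetric_measure \<nu>" unfolding symmetric_measure_def by metis
qed

text \<open>
  The form in which symmetry is compared for the two measures: the law of the mean uses the shape
  \<open>b = a\<close> of the total mass, the parameter measure uses \<open>b = 1\<close>.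
\<close>

lemma symmetric_measure_iff_gamma_mixture:
  assumes fin: "finite_measure \<nu>" and sets: "sets \<nu> = sets borel"
    and pos: "0 < measure \<nu> UNIV" and b: "0 < b"
  shows "symmetric_measure \<nu> \<longleftrightarrow>
    (\<forall>t>0. (\<integral>s. sine_transform \<nu> (t * s) \<partial>gamma_measure b) = 0)"
proof
  assume "symmetric_measure \<nu>"
  then have zero: "\<forall>u>0. sine_transform \<nu> u = 0"
    using symmetric_measure_iff_sine_transform [OF fin sets pos] by simp
  show "\<forall>t>0. (\<integral>s. sine_transform \<nu> (t * s) \<partial>gamma_measure b) = 0"
  proof safe
    fix t :: real assume "0 < t"
    have "AE s in gamma_measure b. sine_transform \<nu> (t * s) = 0"
      using AE_gamma_measure_pos by eventually_elim (use zero \<open>0 < t\<close> in auto)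
    then show "(\<integral>s. sine_transform \<nu> (t * s) \<partial>gamma_measure b) = 0"
      by (rule integral_eq_zero_AE)
  qed
next
  assume "\<forall>t>0. (\<integral>s. sine_transform \<nu> (t * s) \<partial>gamma_measure b) = 0"
  then show "symmetric_measure \<nu>"
    unfolding symmetric_measure_iff_sine_transform [OF fin sets pos]
    using laplace_uniqueness [OF b continuous_sine_transform [OF fin sets]
        sine_transform_bounded [OF fin sets]] by blast
qed

lemma symmetric_measure_arctan:
  assumes sets [measurable_cong]: "sets \<nu> = sets borel" and "symmetric_measure \<nu>"
  shows "(\<integral>x. arctan (t * x) \<partial>\<nu>) = 0"
proof -
  have d: "distr \<nu> borel uminus = \<nu>" using assms symmetric_measure_iff_distr by blast
  have "(\<integral>x. arctan (t * x) \<partial>\<nu>) = (\<integral>x. arctan (t * x) \<partial>distr \<nu> borel uminus)"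
    by (simp add: d)
  also have "\<dots> = - (\<integral>x. arctan (t * x) \<partial>\<nu>)"
    by (subst integral_distr) (auto simp: arctan_minus)
  finally show ?thesis by simp
qed

lemma continuous_integral_arctan:
  assumes "finite_measure \<nu>" and [measurable_cong]: "sets \<nu> = sets borel"
  shows "continuous_on UNIV (\<lambda>t. \<integral>x. arctan (t * x) \<partial>\<nu>)"
  unfolding continuous_on_eq_continuous_at [OF open_UNIV] continuous_at_sequentially
proof safe
  interpret finite_measure \<nu> by fact
  fix u :: real and X :: "nat \<Rightarrow> real" assume X: "X \<longlonglongrightarrow> u"
  have "(\<lambda>n. \<integral>x. arctan (X n * x) \<partial>\<nu>) \<longlonglongrightarrow> (\<integral>x. arctan (u * x) \<partial>\<nu>)"
  proof (rule integral_dominated_convergence [where w = "\<lambda>_. pi / 2"])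
    show "AE x in \<nu>. (\<lambda>n. arctan (X n * x)) \<longlonglongrightarrow> arctan (u * x)"
      using X by (intro AE_I2 tendsto_intros)
    have "\<bar>arctan y\<bar> \<le> pi / 2" for y
      using arctan_bounded [of y] by auto
    then show "AE x in \<nu>. norm (arctan (X n * x)) \<le> pi / 2" for n by simp
  qed auto
  then show "((\<lambda>t. \<integral>x. arctan (t * x) \<partial>\<nu>) \<circ> X) \<longlonglongrightarrow> (\<integral>x. arctan (u * x) \<partial>\<nu>)"
    by (simp add: comp_def)
qed

text \<open>
  The difference quotients of \<open>t \<mapsto> arctan (t x)\<close> are bounded by \<open>1 / t\<close> uniformly in \<open>x\<close>, by the mean
  value theorem, so the derivative in \<open>t\<close> may be taken inside although \<open>\<nu>\<close> need not have a first
  moment. The derivative \<open>x / (1 + (t x)\<^sup>2)\<close> is, up to the factor \<open>t\<close>, the mean of \<open>sin (t s x)\<close> for an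
  exponential variable \<open>s\<close>.
\<close>

lemma integral_arctan_zero_imp_symmetric:
  assumes fin: "finite_measure \<nu>" and sets [measurable_cong]: "sets \<nu> = sets borel"
    and pos: "0 < measure \<nu> UNIV"
    and zero: "\<And>t. 0 < t \<Longrightarrow> (\<integral>x. arctan (t * x) \<partial>\<nu>) = 0"
  shows "symmetric_measure \<nu>"
proof -
  interpret finite_measure \<nu> by fact
  interpret G: prob_space "gamma_measure 1" by (rule prob_space_gamma_measure) simp
  have arctan_int: "integrable \<nu> (\<lambda>x. arctan (t * x))" for t
  proof (rule integrable_const_bound [where B = "pi / 2"])
    have "\<bar>arctan y\<bar> \<le> pi / 2" for y using arctan_bounded [of y] by auto
    then show "AE x in \<nu>. norm (arctan (t * x)) \<le> pi / 2" by simp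
  qed measurable
  have bound: "\<bar>x\<bar> / (1 + (t * x)\<^sup>2) \<le> 1 / t" if "0 < t" for t x :: real
  proof -
    have "0 \<le> (t * \<bar>x\<bar> - 1)\<^sup>2" by simp
    then have "2 * (t * \<bar>x\<bar>) \<le> 1 + (t * x)\<^sup>2"
      by (simp add: power2_eq_square algebra_simps abs_mult_self_eq)
    moreover have "0 \<le> t * \<bar>x\<bar>" using that by simp
    ultimately have "t * \<bar>x\<bar> \<le> 1 + (t * x)\<^sup>2" by linarith
    moreover have "0 < 1 + (t * x)\<^sup>2" by (rule add_pos_nonneg) auto
    ultimately show ?thesis using that by (simp add: field_simps)
  qed
  have deriv: "((\<lambda>t. arctan (t * x)) has_real_derivative x / (1 + (t * x)\<^sup>2)) (at t)" for t x
    by (auto intro!: derivative_eq_intros simp: field_simps)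
  have kernel: "(\<integral>x. x / (1 + (t * x)\<^sup>2) \<partial>\<nu>) = 0" if t: "0 < t" for t
  proof -
    let ?h = "\<lambda>n. inverse (real (Suc n))"
    let ?q = "\<lambda>n x. (arctan ((t + ?h n) * x) - arctan (t * x)) / ?h n"
    have "(\<lambda>n. \<integral>x. ?q n x \<partial>\<nu>) \<longlonglongrightarrow> (\<integral>x. x / (1 + (t * x)\<^sup>2) \<partial>\<nu>)"
    proof (rule integral_dominated_convergence [where w = "\<lambda>_. 1 / t"])
      have "(\<lambda>n. ?q n x) \<longlonglongrightarrow> x / (1 + (t * x)\<^sup>2)" for x
      proof -
        have "((\<lambda>h. (arctan ((t + h) * x) - arctan (t * x)) / h) \<longlongrightarrow> x / (1 + (t * x)\<^sup>2)) (at 0)"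
          using deriv [of x t] by (simp add: DERIV_def)
        moreover have "filterlim ?h (at 0) sequentially"
          using LIMSEQ_inverse_real_of_nat by (intro filterlim_atI) auto
        ultimately show ?thesis by (rule filterlim_compose)
      qed
      then show "AE x in \<nu>. (\<lambda>n. ?q n x) \<longlonglongrightarrow> x / (1 + (t * x)\<^sup>2)" by simp
      have "\<bar>?q n x\<bar> \<le> 1 / t" for n x
      proof -
        have h: "0 < ?h n" by simp
        obtain r where r: "t < r" "arctan ((t + ?h n) * x) - arctan (t * x) = (t + ?h n - t) * (x / (1 + (r * x)\<^sup>2))"
          using MVT2 [of t "t + ?h n" "\<lambda>t. arctan (t * x)" "\<lambda>r. x / (1 + (r * x)\<^sup>2)"] deriv h by auto
        have "?q n x = x / (1 + (r * x)\<^sup>2)" using r(2) h by (simp del: of_nat_Suc)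
        then have "\<bar>?q n x\<bar> = \<bar>x\<bar> / (1 + (r * x)\<^sup>2)" by (simp add: add_nonneg_nonneg)
        also have "\<dots> \<le> 1 / r" using bound [of r x] r(1) t by simp
        also have "\<dots> \<le> 1 / t" using r(1) t by (simp add: frac_le)
        finally show ?thesis .
      qed
      then show "AE x in \<nu>. norm (?q n x) \<le> 1 / t" for n by simp
    qed auto
    moreover have "(\<integral>x. ?q n x \<partial>\<nu>) = 0" for n
    proof -
      have "(\<integral>x. ?q n x \<partial>\<nu>) = ((\<integral>x. arctan ((t + ?h n) * x) \<partial>\<nu>) - (\<integral>x. arctan (t * x) \<partial>\<nu>)) / ?h n"
        using arctan_int by (simp del: of_nat_Suc)
      moreover have "0 < t + ?h n" using t by (intro add_pos_pos) auto
      ultimately show ?thesis using zero [of t] zero [of "t + ?h n"] t by (simp del: of_nat_Suc)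
    qed
    ultimately have "(\<lambda>n. 0) \<longlonglongrightarrow> (\<integral>x. x / (1 + (t * x)\<^sup>2) \<partial>\<nu>)" by (simp only:)
    then show ?thesis using LIMSEQ_unique tendsto_const by blast
  qed
  have "(\<integral>s. sine_transform \<nu> (t * s) \<partial>gamma_measure 1) = 0" if t: "0 < t" for t
  proof -
    interpret pair_sigma_finite \<nu> "gamma_measure 1" by unfold_locales
    interpret pair: finite_measure "\<nu> \<Otimes>\<^sub>M gamma_measure 1"
      by (rule finite_measure_pair_measure) unfold_locales
    have kernel_eq: "(\<integral>s. sin (t * s * x) \<partial>gamma_measure 1) = t * (x / (1 + (t * x)\<^sup>2))" for x
    proof -
      let ?z = "- \<i> * of_real (t * x)"
      have int: "integrable (gamma_measure 1) (\<lambda>s. exp (- (?z * of_real s)))"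
        using integrable_gamma_cexp [of 1 ?z 0] by simp
      have "(\<integral>s. sin (t * s * x) \<partial>gamma_measure 1) = (\<integral>s. Im (exp (- (?z * of_real s))) \<partial>gamma_measure 1)"
        by (simp add: Im_exp mult_ac)
      also have "\<dots> = Im (\<integral>s. exp (- (?z * of_real s)) \<partial>gamma_measure 1)"
        using int by (rule integral_Im)
      also have "\<dots> = Im (exp (- Ln (1 + ?z)))"
        using gamma_laplace [of 1 ?z] by simp
      also have "exp (- Ln (1 + ?z)) = inverse (1 + ?z)"
      proof -
        have "1 + ?z \<noteq> 0" by (auto simp: complex_eq_iff)
        from exp_Ln [OF this] show ?thesis by (simp only: exp_minus)
      qed
      also have "Im (inverse (1 + ?z)) = t * (x / (1 + (t * x)\<^sup>2))"
        by (simp add: power2_eq_square)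
      finally show ?thesis .
    qed
    have "(\<integral>s. \<integral>x. sin (t * s * x) \<partial>\<nu> \<partial>gamma_measure 1) = (\<integral>x. \<integral>s. sin (t * s * x) \<partial>gamma_measure 1 \<partial>\<nu>)"
      by (rule Fubini_integral, rule pair.integrable_const_bound [where B = 1]) auto
    also have "\<dots> = 0"
      using kernel [OF t] by (simp add: kernel_eq del: times_divide_eq_right)
    finally show ?thesis
      unfolding sine_transform_def .
  qed
  then show ?thesis
    using symmetric_measure_iff_gamma_mixture [OF fin sets pos, of 1] by simp
qed

section \<open>Dirichlet vectors and independent gamma variables\<close>

text \<open>
  Dilation by \<open>c\<close> multiplies Lebesgue measure on \<open>\<real>\<^sup>Q\<close> by \<open>c\<close> to the power of the dimension; the
  equality is checked on boxes.
\<close>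

lemma PiM_lborel_scale:
  fixes c :: real
  assumes [simp]: "finite Q" and c: "0 < c"
  shows "(\<Pi>\<^sub>M i\<in>Q. lborel) =
    density (distr (\<Pi>\<^sub>M i\<in>Q. lborel) (\<Pi>\<^sub>M i\<in>Q. lborel) (\<lambda>x. \<lambda>i\<in>Q. c * x i)) (\<lambda>_. ennreal (c ^ card Q))"
    (is "?P = density ?D _")
proof -
  interpret product_sigma_finite "\<lambda>_. lborel :: real measure"
    by unfold_locales
  have "density ?D (\<lambda>_. ennreal (c ^ card Q)) = ?P"
  proof (rule PiM_eqI)
    fix A :: "'a \<Rightarrow> real set" assume A: "\<And>i. i \<in> Q \<Longrightarrow> A i \<in> sets lborel"
    have box: "Pi\<^sub>E Q A \<in> sets ?P"
      using A by (intro sets_PiM_I_finite) auto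
    have pre: "(*) c -` A i \<in> sets lborel" if "i \<in> Q" for i
      using measurable_sets [of "(*) c" borel borel "A i"] A [OF that] by simp
    have scale: "emeasure lborel (A i) = ennreal c * emeasure lborel ((*) c -` A i)" if "i \<in> Q" for i
    proof -
      have "emeasure lborel (A i) = emeasure (density (distr lborel borel ((*) c)) (\<lambda>_. ennreal \<bar>c\<bar>)) (A i)"
        using lborel_distr_mult' [of c] c by simp
      also have "\<dots> = ennreal c * emeasure lborel ((*) c -` A i)"
        using A [OF that] c by (subst emeasure_density_const) (auto simp: emeasure_distr)
      finally show ?thesis .
    qed
    have "(\<lambda>x. \<lambda>i\<in>Q. c * x i) -` Pi\<^sub>E Q A \<inter> space ?P = Pi\<^sub>E Q (\<lambda>i. (*) c -` A i)"
      by (auto simp: space_PiM PiE_iff)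
    then have "emeasure (density ?D (\<lambda>_. ennreal (c ^ card Q))) (Pi\<^sub>E Q A)
        = ennreal (c ^ card Q) * emeasure ?P (Pi\<^sub>E Q (\<lambda>i. (*) c -` A i))"
      using box by (subst emeasure_density_const) (auto simp: emeasure_distr)
    also have "emeasure ?P (Pi\<^sub>E Q (\<lambda>i. (*) c -` A i)) = (\<Prod>i\<in>Q. emeasure lborel ((*) c -` A i))"
      using pre by (intro emeasure_PiM) auto
    also have "ennreal (c ^ card Q) * \<dots> = (\<Prod>i\<in>Q. emeasure lborel (A i))"
      using c by (simp add: scale prod.distrib ennreal_power)
    finally show "emeasure (density ?D (\<lambda>_. ennreal (c ^ card Q))) (Pi\<^sub>E Q A)
        = (\<Prod>i\<in>Q. emeasure lborel (A i))" .
  qed auto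
  then show ?thesis by simp
qed

lemma nn_integral_PiM_lborel_scale:
  fixes c :: real
  assumes [simp]: "finite Q" and c: "0 < c" and [measurable]: "f \<in> borel_measurable (\<Pi>\<^sub>M i\<in>Q. lborel)"
  shows "(\<integral>\<^sup>+ x. f x \<partial>(\<Pi>\<^sub>M i\<in>Q. lborel)) =
    ennreal (c ^ card Q) * (\<integral>\<^sup>+ x. f (\<lambda>i\<in>Q. c * x i) \<partial>(\<Pi>\<^sub>M i\<in>Q. lborel))"
  by (subst PiM_lborel_scale [OF assms(1,2)])
     (simp add: nn_integral_density nn_integral_distr nn_integral_cmult)

text \<open>
  The pointwise identity behind the independence of the gamma coordinates. In the new variables
  \<open>y = s x\<close> the powers of \<open>s\<close> have exponents \<open>\<Sum>p - 1\<close> from the gamma density, \<open>- card Q\<close> from the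
  Jacobian and \<open>1 - p i\<close> from each coordinate of the Dirichlet density; these cancel, while
  \<open>exp (- s)\<close> factorizes because \<open>s\<close> is the sum of the coordinates.
\<close>

lemma dirichlet_density_scaled:
  fixes p y :: "nat \<Rightarrow> real"
  assumes fin: "finite P" and j: "j \<in> P" and p: "\<And>i. i \<in> P \<Longrightarrow> 0 < p i" and s: "0 < s"
  shows "gamma_density (\<Sum>i\<in>P. p i) s * ((1 / s) ^ card (P - {j}) *
       dirichlet_density P j p (\<lambda>i\<in>P - {j}. 1 / s * y i))
     = (\<Prod>i\<in>P - {j}. gamma_density (p i) (y i)) * gamma_density (p j) (s - (\<Sum>i\<in>P - {j}. y i))"
proof (cases "(\<forall>i\<in>P - {j}. 0 < y i) \<and> (\<Sum>i\<in>P - {j}. y i) < s")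
  case True
  let ?Q = "P - {j}"
  define S where "S = (\<Sum>i\<in>?Q. y i)"
  define a where "a = (\<Sum>i\<in>P. p i)"
  have Q: "finite ?Q" using fin by simp
  have y: "\<And>i. i \<in> ?Q \<Longrightarrow> 0 < y i" and S: "S < s" using True by (auto simp: S_def)
  have a: "a = (\<Sum>i\<in>?Q. p i) + p j"
    unfolding a_def using fin j by (simp add: sum.remove)
  have "0 < a" unfolding a_def using p j fin by (intro sum_pos) auto
  then have G: "Gamma a \<noteq> 0" using Gamma_real_pos [of a] by linarith
  have sum: "(\<Sum>i\<in>?Q. (\<lambda>i\<in>?Q. 1 / s * y i) i) = S / s"
    by (simp add: S_def sum_divide_distrib)
  have dens: "dirichlet_density P j p (\<lambda>i\<in>?Q. 1 / s * y i) =
     Gamma a / (\<Prod>i\<in>P. Gamma (p i)) * (\<Prod>i\<in>?Q. (y i / s) powr (p i - 1)) * (1 - S / s) powr (p j - 1)"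
    unfolding dirichlet_density_def sum a_def using s S y by simp
  have 1: "(\<Prod>i\<in>?Q. (y i / s) powr (p i - 1)) =
      (\<Prod>i\<in>?Q. y i powr (p i - 1)) * s powr (real (card ?Q) - (\<Sum>i\<in>?Q. p i))"
  proof -
    have "(\<Prod>i\<in>?Q. (y i / s) powr (p i - 1)) = (\<Prod>i\<in>?Q. y i powr (p i - 1) * s powr (1 - p i))"
      using s y by (intro prod.cong) (auto simp: powr_divide less_imp_le powr_diff field_simps)
    also have "\<dots> = (\<Prod>i\<in>?Q. y i powr (p i - 1)) * s powr (\<Sum>i\<in>?Q. 1 - p i)"
      using s Q by (simp add: prod.distrib powr_sum)
    finally show ?thesis by (simp add: sum_subtractf)
  qed
  have 2: "(1 - S / s) powr (p j - 1) = (s - S) powr (p j - 1) * s powr (1 - p j)"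
  proof -
    have "1 - S / s = (s - S) / s" using s by (simp add: field_simps)
    then have "(1 - S / s) powr (p j - 1) = (s - S) powr (p j - 1) / s powr (p j - 1)"
      using s S by (simp add: powr_divide)
    moreover have "s powr (1 - p j) = inverse (s powr (p j - 1))"
      using powr_minus [of s "p j - 1"] by simp
    ultimately show ?thesis by (simp add: divide_inverse)
  qed
  have 3: "(1 / s) ^ card ?Q = s powr (- real (card ?Q))"
    using s by (simp add: powr_minus powr_realpow power_one_over inverse_eq_divide)
  have 4: "s powr (a - 1) * s powr (- real (card ?Q)) * s powr (real (card ?Q) - (\<Sum>i\<in>?Q. p i))
      * s powr (1 - p j) = 1"
    using s by (simp add: a flip: powr_add)
  have 5: "exp (- s) = (\<Prod>i\<in>?Q. exp (- y i)) * exp (- (s - S))"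
    using Q by (simp add: S_def sum_negf flip: exp_sum exp_add)
  have 6: "(\<Prod>i\<in>P. Gamma (p i)) = (\<Prod>i\<in>?Q. Gamma (p i)) * Gamma (p j)"
    using fin j by (simp add: prod.remove)
  have 7: "(\<Prod>i\<in>?Q. gamma_density (p i) (y i)) =
     (\<Prod>i\<in>?Q. y i powr (p i - 1)) * (\<Prod>i\<in>?Q. exp (- y i)) / (\<Prod>i\<in>?Q. Gamma (p i))"
    using y by (simp add: gamma_density_def prod.distrib prod_dividef)
  have 8: "gamma_density (p j) (s - S) = (s - S) powr (p j - 1) * exp (- (s - S)) / Gamma (p j)"
    using S by (simp add: gamma_density_def)
  have 9: "gamma_density a s = s powr (a - 1) * exp (- s) / Gamma a"
    using s by (simp add: gamma_density_def)
  define Y E GQ where "Y = (\<Prod>i\<in>?Q. y i powr (p i - 1))"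
    and "E = (\<Prod>i\<in>?Q. exp (- y i))" and "GQ = (\<Prod>i\<in>?Q. Gamma (p i))"
  have "gamma_density a s * ((1 / s) ^ card ?Q * dirichlet_density P j p (\<lambda>i\<in>?Q. 1 / s * y i)) =
      (s powr (a - 1) * s powr (- real (card ?Q)) * s powr (real (card ?Q) - (\<Sum>i\<in>?Q. p i))
      * s powr (1 - p j)) * (Gamma a / Gamma a) *
      (Y * E / GQ) * ((s - S) powr (p j - 1) * exp (- (s - S)) / Gamma (p j))"
    unfolding dens 1 2 3 5 6 9 Y_def [symmetric] E_def [symmetric] GQ_def [symmetric]
    by (simp only: times_divide_eq_left times_divide_eq_right mult_ac divide_divide_eq_left)
  also have "\<dots> = (Y * E / GQ) * ((s - S) powr (p j - 1) * exp (- (s - S)) / Gamma (p j))"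
    unfolding 4 using G by simp
  finally show ?thesis
    unfolding 7 a_def [symmetric] S_def [symmetric] 8 Y_def [symmetric] E_def [symmetric] GQ_def [symmetric] .
next
  case False
  let ?Q = "P - {j}"
  have sum: "(\<Sum>i\<in>?Q. (\<lambda>i\<in>?Q. 1 / s * y i) i) = (\<Sum>i\<in>?Q. y i) / s"
    by (simp add: sum_divide_distrib)
  have "dirichlet_density P j p (\<lambda>i\<in>?Q. 1 / s * y i) = 0"
    unfolding dirichlet_density_def sum using s False by (auto simp: zero_less_divide_iff)
  moreover have "(\<Prod>i\<in>?Q. gamma_density (p i) (y i)) * gamma_density (p j) (s - (\<Sum>i\<in>?Q. y i)) = 0"
  proof (cases "\<forall>i\<in>?Q. 0 < y i")
    case True
    then have "\<not> (\<Sum>i\<in>?Q. y i) < s" using False by blast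
    then show ?thesis by (simp add: gamma_density_def)
  next
    case False
    then obtain i where "i \<in> ?Q" "\<not> 0 < y i" by blast
    then have "(\<Prod>i\<in>?Q. gamma_density (p i) (y i)) = 0"
      using fin by (intro prod_zero) (auto simp: gamma_density_def intro!: bexI [of _ i])
    then show ?thesis by simp
  qed
  ultimately show ?thesis by simp
qed

lemma borel_measurable_dirichlet_density [measurable]:
  "finite P \<Longrightarrow> dirichlet_density P j p \<in> borel_measurable (\<Pi>\<^sub>M i\<in>P - {j}. lborel)"
  unfolding dirichlet_density_def [abs_def] by measurable

lemma measurable_scaled_simplex_point:
  assumes [measurable_cong]: "sets N = sets borel" "sets D = sets (\<Pi>\<^sub>M i\<in>P - {j}. (lborel :: real measure))"
  shows "(\<lambda>(s, x). \<lambda>i\<in>P. s * (if i = j then 1 - (\<Sum>k\<in>P - {j}. x k) else x i))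
    \<in> measurable (N \<Otimes>\<^sub>M D) (\<Pi>\<^sub>M i\<in>P. borel)"
proof (subst split_beta', rule measurable_restrict)
  let ?Q = "P - {j}"
  fix i assume "i \<in> P"
  have "(\<lambda>x. fst x * (1 - (\<Sum>k\<in>?Q. snd x k))) \<in> borel_measurable (N \<Otimes>\<^sub>M D)"
    by measurable
  moreover have "(\<lambda>x. fst x * snd x i) \<in> borel_measurable (N \<Otimes>\<^sub>M D)" if "i \<noteq> j"
  proof -
    from that \<open>i \<in> P\<close> have [measurable]: "i \<in> ?Q" by simp
    show ?thesis by measurable
  qed
  ultimately show "(\<lambda>x. fst x * (if i = j then 1 - (\<Sum>k\<in>?Q. snd x k) else snd x i))
      \<in> borel_measurable (N \<Otimes>\<^sub>M D)"
    by (cases "i = j") simp_all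
qed

text \<open>
  A Dirichlet vector multiplied by an independent gamma variable \<open>s\<close> whose shape is the total
  parameter has independent gamma coordinates. On a box, the change of variables \<open>y = s x\<close> for
  fixed \<open>s\<close>, an exchange of the integrals and the translation \<open>r = s - \<Sum>y\<close> turn the probability
  into a product of one-dimensional integrals.
\<close>

lemma gamma_times_dirichlet:
  fixes p :: "nat \<Rightarrow> real"
  assumes fin: "finite P" and j: "j \<in> P" and p: "\<And>i. i \<in> P \<Longrightarrow> 0 < p i"
  defines "D \<equiv> density (\<Pi>\<^sub>M i\<in>P - {j}. lborel) (\<lambda>x. ennreal (dirichlet_density P j p x))"
  shows "distr (gamma_measure (\<Sum>i\<in>P. p i) \<Otimes>\<^sub>M D) (\<Pi>\<^sub>M i\<in>P. borel)
      (\<lambda>(s, x). \<lambda>i\<in>P. s * (if i = j then 1 - (\<Sum>k\<in>P - {j}. x k) else x i))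
    = (\<Pi>\<^sub>M i\<in>P. gamma_measure (p i))"
proof -
  let ?Q = "P - {j}"
  let ?L = "\<Pi>\<^sub>M i\<in>?Q. (lborel :: real measure)"
  let ?a = "\<Sum>i\<in>P. p i"
  define T where "T = (\<lambda>(s, x). \<lambda>i\<in>P. s * (if i = j then 1 - (\<Sum>k\<in>?Q. x k) else x i :: real))"
  have Q: "finite ?Q" using fin by simp
  have a: "0 < ?a" using p j fin by (intro sum_pos) auto
  \<comment> \<open>Outside \<open>P\<close> the shape is set to \<open>1\<close>, so that the family consists of probability measures for
    every index.\<close>
  define p' where "p' i = (if i \<in> P then p i else 1)" for i
  have p': "0 < p' i" for i using p by (simp add: p'_def)
  interpret G: product_prob_space "\<lambda>i. gamma_measure (p' i)"
    using prob_space_gamma_measure [OF p'] by (intro product_prob_spaceI) auto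
  interpret B: product_sigma_finite "\<lambda>_::nat. lborel :: real measure"
    by unfold_locales
  interpret L: sigma_finite_measure ?L
    using Q by (rule B.sigma_finite)
  have [measurable_cong]: "sets D = sets ?L" by (simp add: D_def)
  have [measurable]: "dirichlet_density P j p \<in> borel_measurable ?L"
    using fin by measurable
  interpret D: sigma_finite_measure D
    unfolding D_def by (subst L.sigma_finite_iff_density_finite) auto
  have T [measurable]: "T \<in> measurable (gamma_measure ?a \<Otimes>\<^sub>M D) (\<Pi>\<^sub>M i\<in>P. borel)"
    unfolding T_def by (rule measurable_scaled_simplex_point) (simp_all add: D_def)
  have T': "T \<in> measurable (borel \<Otimes>\<^sub>M ?L) (\<Pi>\<^sub>M i\<in>P. borel)"
    using T by (simp cong: measurable_cong_sets)
  have "distr (gamma_measure ?a \<Otimes>\<^sub>M D) (\<Pi>\<^sub>M i\<in>P. borel) T = (\<Pi>\<^sub>M i\<in>P. gamma_measure (p' i))"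
  proof (rule G.PiM_eqI)
    show "sets (distr (gamma_measure ?a \<Otimes>\<^sub>M D) (\<Pi>\<^sub>M i\<in>P. borel) T) = sets (\<Pi>\<^sub>M i\<in>P. gamma_measure (p' i))"
      by (simp cong: sets_PiM_cong)
    fix A :: "nat \<Rightarrow> real set" assume "\<And>i. i \<in> P \<Longrightarrow> A i \<in> sets (gamma_measure (p' i))"
    then have A: "\<And>i. i \<in> P \<Longrightarrow> A i \<in> sets borel" by simp
    define f where "f i r = ennreal (gamma_density (p i) r) * indicator (A i) r" for i r
    have f [measurable]: "f i \<in> borel_measurable borel" if "i \<in> P" for i
      using A [OF that] unfolding f_def [abs_def] by measurable
    have fj [measurable]: "f j \<in> borel_measurable borel" using f j by simp
    have prodf [measurable]: "(\<lambda>y. \<Prod>i\<in>?Q. f i (y i)) \<in> borel_measurable ?L"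
    proof (rule borel_measurable_prod_ennreal)
      fix i assume i [measurable]: "i \<in> ?Q"
      then have [measurable]: "f i \<in> borel_measurable borel" using f by simp
      show "(\<lambda>y. f i (y i)) \<in> borel_measurable ?L" by measurable
    qed
    have box: "Pi\<^sub>E P A \<in> sets (\<Pi>\<^sub>M i\<in>P. borel)"
      using A fin by (intro sets_PiM_I_finite) auto
    have ind: "(indicator (Pi\<^sub>E P A) :: _ \<Rightarrow> ennreal) \<in> borel_measurable (\<Pi>\<^sub>M i\<in>P. borel)"
      using box by simp
    have indT: "(\<lambda>x. indicator (Pi\<^sub>E P A) (T (s, x)) :: ennreal) \<in> borel_measurable ?L" for s
    proof -
      have "(\<lambda>x. T (s, x)) \<in> measurable ?L (\<Pi>\<^sub>M i\<in>P. borel)"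
        using T' by measurable
      then show ?thesis using box by measurable
    qed
    have inner: "ennreal (gamma_density ?a s) *
          (\<integral>\<^sup>+ x. ennreal (dirichlet_density P j p x) * indicator (Pi\<^sub>E P A) (T (s, x)) \<partial>?L)
        = (\<integral>\<^sup>+ y. (\<Prod>i\<in>?Q. f i (y i)) * f j (s - (\<Sum>i\<in>?Q. y i)) \<partial>?L)" for s
    proof (cases "0 < s")
      case True
      let ?y = "\<lambda>y. \<lambda>i\<in>?Q. 1 / s * y i"
      have Ty: "T (s, ?y y) = (\<lambda>i\<in>P. if i = j then s - (\<Sum>k\<in>?Q. y k) else y i)" for y
      proof -
        have "(\<Sum>k\<in>?Q. ?y y k) = (\<Sum>k\<in>?Q. y k) / s" by (simp add: sum_divide_distrib)
        then show ?thesis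
          using True by (auto simp: T_def fun_eq_iff restrict_def field_simps)
      qed
      have ind': "indicator (Pi\<^sub>E P A) (T (s, ?y y)) =
          (\<Prod>i\<in>?Q. indicator (A i) (y i)) * (indicator (A j) (s - (\<Sum>k\<in>?Q. y k)) :: ennreal)" for y
      proof (cases "\<forall>i\<in>?Q. y i \<in> A i")
        case True
        then have "(\<Prod>i\<in>?Q. indicator (A i) (y i)) = (1::ennreal)" by (intro prod.neutral) auto
        then show ?thesis unfolding Ty using True j by (auto simp: indicator_def PiE_iff)
      next
        case False
        then obtain i where i: "i \<in> ?Q" "y i \<notin> A i" by blast
        then have "(\<Prod>i\<in>?Q. indicator (A i) (y i)) = (0::ennreal)"
          using Q by (intro prod_zero bexI [of _ i]) auto
        moreover have "T (s, ?y y) \<notin> Pi\<^sub>E P A" unfolding Ty using i by (auto simp: PiE_iff)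
        ultimately show ?thesis by simp
      qed
      have pos: "0 \<le> gamma_density ?a s" "0 \<le> (1 / s) ^ card ?Q"
        using gamma_density_nonneg [OF a] True by auto
      have pw: "ennreal (gamma_density ?a s) * (ennreal ((1 / s) ^ card ?Q) *
          (ennreal (dirichlet_density P j p (?y y)) * indicator (Pi\<^sub>E P A) (T (s, ?y y)))) =
          (\<Prod>i\<in>?Q. f i (y i)) * f j (s - (\<Sum>i\<in>?Q. y i))" for y
      proof -
        have nn: "0 \<le> gamma_density (p i) r" if "i \<in> P" for i r
          using gamma_density_nonneg [OF p [OF that]] .
        have "ennreal (gamma_density ?a s) * (ennreal ((1 / s) ^ card ?Q) *
          ennreal (dirichlet_density P j p (?y y))) =
          ennreal (gamma_density ?a s * ((1 / s) ^ card ?Q * dirichlet_density P j p (?y y)))"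
          using pos by (simp only: ennreal_mult')
        also have "\<dots> = (\<Prod>i\<in>?Q. ennreal (gamma_density (p i) (y i))) *
            ennreal (gamma_density (p j) (s - (\<Sum>i\<in>?Q. y i)))"
        proof -
          have "gamma_density ?a s * ((1 / s) ^ card ?Q * dirichlet_density P j p (?y y)) =
            (\<Prod>i\<in>?Q. gamma_density (p i) (y i)) * gamma_density (p j) (s - (\<Sum>i\<in>?Q. y i))"
            using fin j p True by (rule dirichlet_density_scaled)
          moreover have "0 \<le> (\<Prod>i\<in>?Q. gamma_density (p i) (y i))"
            using nn by (intro prod_nonneg) auto
          moreover have "ennreal (\<Prod>i\<in>?Q. gamma_density (p i) (y i)) =
              (\<Prod>i\<in>?Q. ennreal (gamma_density (p i) (y i)))"
            using nn by (intro prod_ennreal [symmetric]) auto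
          ultimately show ?thesis by (simp only: ennreal_mult')
        qed
        finally have *: "ennreal (gamma_density ?a s) * (ennreal ((1 / s) ^ card ?Q) *
          ennreal (dirichlet_density P j p (?y y))) = (\<Prod>i\<in>?Q. ennreal (gamma_density (p i) (y i))) *
            ennreal (gamma_density (p j) (s - (\<Sum>i\<in>?Q. y i)))" .
        have "ennreal (gamma_density ?a s) * (ennreal ((1 / s) ^ card ?Q) *
          (ennreal (dirichlet_density P j p (?y y)) * indicator (Pi\<^sub>E P A) (T (s, ?y y)))) =
          (ennreal (gamma_density ?a s) * (ennreal ((1 / s) ^ card ?Q) *
          ennreal (dirichlet_density P j p (?y y)))) * indicator (Pi\<^sub>E P A) (T (s, ?y y))"
          by (simp only: mult.assoc)
        also have "\<dots> = (\<Prod>i\<in>?Q. f i (y i)) * f j (s - (\<Sum>i\<in>?Q. y i))"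
          unfolding * ind' f_def prod.distrib by (simp only: mult_ac)
        finally show ?thesis .
      qed
      have "ennreal (gamma_density ?a s) *
          (\<integral>\<^sup>+ x. ennreal (dirichlet_density P j p x) * indicator (Pi\<^sub>E P A) (T (s, x)) \<partial>?L)
        = ennreal (gamma_density ?a s) * (ennreal ((1 / s) ^ card ?Q) *
          (\<integral>\<^sup>+ y. ennreal (dirichlet_density P j p (?y y)) * indicator (Pi\<^sub>E P A) (T (s, ?y y)) \<partial>?L))"
        using indT [of s] True Q by (subst nn_integral_PiM_lborel_scale [of ?Q "1 / s"]) auto
      also have "\<dots> = (\<integral>\<^sup>+ y. ennreal (gamma_density ?a s) * (ennreal ((1 / s) ^ card ?Q) *
          (ennreal (dirichlet_density P j p (?y y)) * indicator (Pi\<^sub>E P A) (T (s, ?y y)))) \<partial>?L)"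
      proof -
        have "?y \<in> measurable ?L ?L"
          by (rule measurable_restrict) (auto intro!: borel_measurable_times)
        then have "(\<lambda>y. ennreal (dirichlet_density P j p (?y y)) * indicator (Pi\<^sub>E P A) (T (s, ?y y)))
            \<in> borel_measurable ?L"
          by (rule measurable_compose [of ?y _ _ "\<lambda>x. ennreal (dirichlet_density P j p x) * indicator (Pi\<^sub>E P A) (T (s, x))"])
             (use indT [of s] in measurable)
        then show ?thesis by (simp add: nn_integral_cmult)
      qed
      also have "\<dots> = (\<integral>\<^sup>+ y. (\<Prod>i\<in>?Q. f i (y i)) * f j (s - (\<Sum>i\<in>?Q. y i)) \<partial>?L)"
        unfolding pw ..
      finally show ?thesis .
    next
      case False
      have "(\<Prod>i\<in>?Q. f i (y i)) * f j (s - (\<Sum>i\<in>?Q. y i)) = 0" for y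
      proof (cases "\<forall>i\<in>?Q. 0 < y i")
        case True
        then have "0 \<le> (\<Sum>i\<in>?Q. y i)" by (intro sum_nonneg) (auto intro: less_imp_le)
        then show ?thesis using False by (simp add: f_def gamma_density_def)
      next
        case nonpos: False
        then obtain i where "i \<in> ?Q" "\<not> 0 < y i" by blast
        then have "(\<Prod>i\<in>?Q. f i (y i)) = 0"
          using Q by (intro prod_zero bexI [of _ i]) (auto simp: f_def gamma_density_def)
        then show ?thesis by simp
      qed
      then have "(\<integral>\<^sup>+ y. (\<Prod>i\<in>?Q. f i (y i)) * f j (s - (\<Sum>i\<in>?Q. y i)) \<partial>?L) = 0"
        by (simp only: nn_integral_const mult_zero_left)
      then show ?thesis using False by (simp add: gamma_density_def)
    qed
    have "emeasure (distr (gamma_measure ?a \<Otimes>\<^sub>M D) (\<Pi>\<^sub>M i\<in>P. borel) T) (Pi\<^sub>E P A) =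
        (\<integral>\<^sup>+ z. indicator (Pi\<^sub>E P A) z \<partial>distr (gamma_measure ?a \<Otimes>\<^sub>M D) (\<Pi>\<^sub>M i\<in>P. borel) T)"
      using box by simp
    also have "\<dots> = (\<integral>\<^sup>+ z. indicator (Pi\<^sub>E P A) (T z) \<partial>(gamma_measure ?a \<Otimes>\<^sub>M D))"
      using box T by (intro nn_integral_distr) auto
    also have "\<dots> = (\<integral>\<^sup>+ s. \<integral>\<^sup>+ x. indicator (Pi\<^sub>E P A) (T (s, x)) \<partial>D \<partial>gamma_measure ?a)"
      by (intro D.nn_integral_fst [symmetric] measurable_compose [OF T ind])
    also have "\<dots> = (\<integral>\<^sup>+ s. \<integral>\<^sup>+ x. ennreal (dirichlet_density P j p x) *
         indicator (Pi\<^sub>E P A) (T (s, x)) \<partial>?L \<partial>gamma_measure ?a)"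
      unfolding D_def using indT by (subst nn_integral_density) auto
    also have "\<dots> = (\<integral>\<^sup>+ s. ennreal (gamma_density ?a s) * (\<integral>\<^sup>+ x. ennreal (dirichlet_density P j p x) *
         indicator (Pi\<^sub>E P A) (T (s, x)) \<partial>?L) \<partial>lborel)"
    proof -
      have [measurable]: "(\<lambda>(s, x). ennreal (dirichlet_density P j p x) * indicator (Pi\<^sub>E P A) (T (s, x)))
          \<in> borel_measurable (borel \<Otimes>\<^sub>M ?L)"
        unfolding split_beta' using measurable_compose [OF T' ind] by measurable
      have "(\<lambda>s. \<integral>\<^sup>+ x. ennreal (dirichlet_density P j p x) * indicator (Pi\<^sub>E P A) (T (s, x)) \<partial>?L)
          \<in> borel_measurable borel"
        by (rule L.borel_measurable_nn_integral) measurable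
      then show ?thesis unfolding gamma_measure_def by (subst nn_integral_density) auto
    qed
    also have "\<dots> = (\<integral>\<^sup>+ s. \<integral>\<^sup>+ y. (\<Prod>i\<in>?Q. f i (y i)) * f j (s - (\<Sum>i\<in>?Q. y i)) \<partial>?L \<partial>lborel)"
      unfolding inner ..
    also have "\<dots> = (\<integral>\<^sup>+ y. \<integral>\<^sup>+ s. (\<Prod>i\<in>?Q. f i (y i)) * f j (s - (\<Sum>i\<in>?Q. y i)) \<partial>lborel \<partial>?L)"
    proof -
      interpret pair_sigma_finite ?L "lborel :: real measure" by unfold_locales
      show ?thesis by (intro Fubini') measurable
    qed
    also have "\<dots> = (\<integral>\<^sup>+ y. (\<Prod>i\<in>?Q. f i (y i)) * (\<integral>\<^sup>+ r. f j r \<partial>lborel) \<partial>?L)"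
    proof (rule nn_integral_cong)
      fix y
      have "(\<integral>\<^sup>+ r. f j r \<partial>lborel) = (\<integral>\<^sup>+ s. f j (s - (\<Sum>i\<in>?Q. y i)) \<partial>lborel)"
        by (subst nn_integral_real_affine [of _ 1 "- (\<Sum>i\<in>?Q. y i)"]) auto
      then show "(\<integral>\<^sup>+ s. (\<Prod>i\<in>?Q. f i (y i)) * f j (s - (\<Sum>i\<in>?Q. y i)) \<partial>lborel) =
          (\<Prod>i\<in>?Q. f i (y i)) * (\<integral>\<^sup>+ r. f j r \<partial>lborel)"
        by (simp add: nn_integral_cmult)
    qed
    also have "\<dots> = (\<Prod>i\<in>?Q. \<integral>\<^sup>+ r. f i r \<partial>lborel) * (\<integral>\<^sup>+ r. f j r \<partial>lborel)"
    proof -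
      have "(\<integral>\<^sup>+ y. (\<Prod>i\<in>?Q. f i (y i)) \<partial>?L) = (\<Prod>i\<in>?Q. \<integral>\<^sup>+ r. f i r \<partial>lborel)"
        using Q f by (intro B.product_nn_integral_prod) auto
      then show ?thesis by (simp add: nn_integral_multc)
    qed
    also have "\<dots> = (\<Prod>i\<in>P. \<integral>\<^sup>+ r. f i r \<partial>lborel)"
      using fin j by (simp add: prod.remove mult.commute)
    also have "\<dots> = (\<Prod>i\<in>P. emeasure (gamma_measure (p' i)) (A i))"
      unfolding f_def gamma_measure_def p'_def using A
      by (intro prod.cong) (auto simp: emeasure_density)
    finally show "emeasure (distr (gamma_measure ?a \<Otimes>\<^sub>M D) (\<Pi>\<^sub>M i\<in>P. borel) T) (Pi\<^sub>E P A) =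
        (\<Prod>i\<in>P. emeasure (gamma_measure (p' i)) (A i))" .
  qed (fact fin)
  also have "\<dots> = (\<Pi>\<^sub>M i\<in>P. gamma_measure (p i))"
    by (rule PiM_cong) (auto simp: p'_def)
  finally show ?thesis unfolding T_def .
qed

text \<open>
  The consequence for a Dirichlet vector with coordinates \<open>0, \<dots>, n\<close>, the last one being one minus
  the sum of the others. Vanishing parameters contribute the factor 1 on the right and vanishing
  coordinates on the left, so both sides reduce to the set \<open>P\<close> of indices with positive parameter.
\<close>

lemma dirichlet_gamma_laplace:
  fixes p :: "nat \<Rightarrow> real" and z :: "nat \<Rightarrow> complex"
  assumes p: "\<And>i. i \<le> n \<Longrightarrow> 0 \<le> p i" and pos: "0 < (\<Sum>i\<le>n. p i)"
    and z: "\<And>i. i \<le> n \<Longrightarrow> 0 \<le> Re (z i)"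
  shows "(\<integral>s. \<integral>x. exp (- (of_real s * ((\<Sum>i<n. z i * of_real (x i)) + z n * of_real (1 - (\<Sum>i<n. x i)))))
       \<partial>dirichlet n p \<partial>gamma_measure (\<Sum>i\<le>n. p i))
     = (\<Prod>i\<le>n. exp (- of_real (p i) * Ln (1 + z i)))"
proof -
  define P where "P = {i. i \<le> n \<and> 0 < p i}"
  define j where "j = Max P"
  let ?Q = "P - {j}"
  let ?L = "\<Pi>\<^sub>M i\<in>?Q. (lborel :: real measure)"
  have fin: "finite P" by (simp add: P_def)
  have sumP: "(\<Sum>i\<le>n. p i) = (\<Sum>i\<in>P. p i)"
    using p by (intro sum.mono_neutral_right) (auto simp: P_def not_less intro: antisym)
  have "P \<noteq> {}"
    using pos by (auto simp: sumP)
  then have j: "j \<in> P" unfolding j_def using fin by (intro Max_in) auto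
  have Pn: "P \<subseteq> {..n}" and pP: "\<And>i. i \<in> P \<Longrightarrow> 0 < p i" by (auto simp: P_def)
  have jn: "i < n \<or> i = j" if "i \<in> P" for i
  proof -
    have "i \<le> j" unfolding j_def using fin that by simp
    then show ?thesis using Pn that j by (cases "i = n") auto
  qed
  define a where "a = (\<Sum>i\<in>P. p i)"
  have a: "0 < a" using pos sumP by (simp add: a_def)
  define D where "D = density ?L (\<lambda>x. ennreal (dirichlet_density P j p x))"
  define V where "V = (\<lambda>x. \<lambda>i\<in>{..<n}. if i = j then 1 - (\<Sum>k\<in>?Q. x k) else if i \<in> P then x i else (0::real))"
  define T where "T = (\<lambda>(s, x). \<lambda>i\<in>P. s * (if i = j then 1 - (\<Sum>k\<in>?Q. x k) else x i :: real))"
  interpret G: prob_space "gamma_measure a" using a by (rule prob_space_gamma_measure)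
  interpret B: product_sigma_finite "\<lambda>_::nat. lborel :: real measure" by unfold_locales
  interpret L: sigma_finite_measure ?L using fin by (intro B.sigma_finite) auto
  have [measurable_cong]: "sets D = sets ?L" by (simp add: D_def)
  have [measurable]: "dirichlet_density P j p \<in> borel_measurable ?L" using fin by measurable
  interpret D: sigma_finite_measure D
    unfolding D_def by (subst L.sigma_finite_iff_density_finite) auto
  define p' where "p' i = (if i \<in> P then p i else 1)" for i
  have p': "0 < p' i" for i using pP by (simp add: p'_def)
  interpret GP: product_prob_space "\<lambda>i. gamma_measure (p' i)"
    using prob_space_gamma_measure [OF p'] by (intro product_prob_spaceI) auto
  have dT: "distr (gamma_measure a \<Otimes>\<^sub>M D) (\<Pi>\<^sub>M i\<in>P. borel) T = (\<Pi>\<^sub>M i\<in>P. gamma_measure (p' i))"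
  proof -
    have "(\<Pi>\<^sub>M i\<in>P. gamma_measure (p' i)) = (\<Pi>\<^sub>M i\<in>P. gamma_measure (p i))"
      by (rule PiM_cong) (auto simp: p'_def)
    then show ?thesis
      unfolding D_def T_def a_def using gamma_times_dirichlet [OF fin j pP] by simp
  qed
  have T [measurable]: "T \<in> measurable (gamma_measure a \<Otimes>\<^sub>M D) (\<Pi>\<^sub>M i\<in>P. borel)"
    unfolding T_def by (rule measurable_scaled_simplex_point) (simp_all add: D_def)
  have "emeasure D (space D) = 1"
  proof -
    have "prob_space (distr (gamma_measure a \<Otimes>\<^sub>M D) (\<Pi>\<^sub>M i\<in>P. borel) T)"
      unfolding dT by (rule prob_space_PiM) (rule prob_space_gamma_measure [OF p'])
    then have "prob_space (gamma_measure a \<Otimes>\<^sub>M D)"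
      by (rule prob_space_distrD [OF T])
    then have "1 = emeasure (gamma_measure a \<Otimes>\<^sub>M D) (space (gamma_measure a) \<times> space D)"
      by (metis prob_space.emeasure_space_1 space_pair_measure)
    also have "\<dots> = emeasure D (space D)"
      by (subst D.emeasure_pair_measure_Times) (auto simp: G.emeasure_space_1 [simplified])
    finally show ?thesis by simp
  qed
  then interpret D: prob_space D by (rule prob_spaceI)
  interpret GD: pair_prob_space "gamma_measure a" D ..
  have dir: "dirichlet n p = distr D (\<Pi>\<^sub>M i\<in>{..<n}. borel) V"
    unfolding dirichlet_def Let_def P_def [symmetric] j_def [symmetric] D_def V_def ..
  have V [measurable]: "V \<in> measurable D (\<Pi>\<^sub>M i\<in>{..<n}. borel)"
    unfolding V_def
  proof (rule measurable_restrict)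
    fix i
    have "(\<lambda>x. 1 - (\<Sum>k\<in>?Q. x k)) \<in> borel_measurable D" by measurable
    moreover have "(\<lambda>x. x i) \<in> borel_measurable D" if "i \<noteq> j" "i \<in> P"
    proof -
      from that have [measurable]: "i \<in> ?Q" by simp
      show ?thesis by measurable
    qed
    ultimately show "(\<lambda>x. if i = j then 1 - (\<Sum>k\<in>?Q. x k) else if i \<in> P then x i else 0) \<in> borel_measurable D"
      by (cases "i = j"; cases "i \<in> P") simp_all
  qed
  \<comment> \<open>In the coordinates of the density, \<open>V x\<close> together with its complement is the vector that
    equals \<open>T (1, x)\<close> on \<open>P\<close> and zero elsewhere, whether or not \<open>n\<close> belongs to \<open>P\<close>.\<close>
  have lin: "of_real s * ((\<Sum>i<n. z i * of_real (V x i)) + z n * of_real (1 - (\<Sum>i<n. V x i)))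
      = (\<Sum>i\<in>P. z i * of_real (T (s, x) i))" for s x
  proof -
    define v where "v i = (if i = j then 1 - (\<Sum>k\<in>?Q. x k) else if i \<in> P then x i else 0)" for i
    have sum_v: "(\<Sum>i\<le>n. w i * of_real (v i)) = (\<Sum>i\<in>P. w i * of_real (v i))" for w :: "nat \<Rightarrow> complex"
      using Pn j by (intro sum.mono_neutral_right) (auto simp: v_def)
    have "(\<Sum>i\<le>n. of_real (v i)) = (\<Sum>i\<in>P. of_real (v i) :: complex)"
      using sum_v [of "\<lambda>_. 1"] by simp
    also have "\<dots> = of_real (\<Sum>i\<in>P. v i)" by simp
    also have "(\<Sum>i\<in>P. v i) = v j + (\<Sum>i\<in>?Q. v i)" using fin j by (rule sum.remove)
    also have "\<dots> = 1" by (simp add: v_def)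
    finally have total: "(\<Sum>i\<le>n. v i) = 1"
      by (metis of_real_1 of_real_eq_iff of_real_sum)
    have "(\<Sum>i<n. V x i) = (\<Sum>i<n. v i)" by (simp add: V_def v_def)
    then have last: "1 - (\<Sum>i<n. V x i) = v n"
      using total by (simp add: lessThan_Suc_atMost [symmetric])
    have "(\<Sum>i<n. z i * of_real (V x i)) + z n * of_real (1 - (\<Sum>i<n. V x i)) = (\<Sum>i\<le>n. z i * of_real (v i))"
      unfolding last by (simp add: V_def v_def lessThan_Suc_atMost [symmetric])
    also have "\<dots> = (\<Sum>i\<in>P. z i * of_real (v i))" by (rule sum_v)
    finally show ?thesis
      unfolding sum_distrib_left by (auto simp: T_def v_def sum_distrib_left intro!: sum.cong)
  qed
  define E where "E y = exp (- (\<Sum>i\<in>P. z i * of_real (y i)))" for y :: "nat \<Rightarrow> real"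
  have E [measurable]: "E \<in> borel_measurable (\<Pi>\<^sub>M i\<in>P. borel)"
    unfolding E_def [abs_def] by measurable
  have "(\<integral>s. \<integral>x. exp (- (of_real s * ((\<Sum>i<n. z i * of_real (x i)) + z n * of_real (1 - (\<Sum>i<n. x i)))))
       \<partial>dirichlet n p \<partial>gamma_measure a) = (\<integral>s. \<integral>x. E (T (s, x)) \<partial>D \<partial>gamma_measure a)"
    unfolding dir E_def lin [symmetric]
    by (intro Bochner_Integration.integral_cong [OF refl] integral_distr) measurable
  also have "\<dots> = (\<integral>y. E (T y) \<partial>(gamma_measure a \<Otimes>\<^sub>M D))"
  proof (rule GD.integral_fst')
    have "AE y in (\<Pi>\<^sub>M i\<in>P. gamma_measure (p' i)). norm (E y) \<le> 1"
    proof -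
      have "AE y in (\<Pi>\<^sub>M i\<in>P. gamma_measure (p' i)). \<forall>i\<in>P. 0 < y i"
        using fin by (intro AE_finite_allI AE_PiM_component prob_space_gamma_measure p' AE_gamma_measure_pos)
      then show ?thesis
      proof eventually_elim
        case (elim y)
        have "0 \<le> (\<Sum>i\<in>P. Re (z i) * y i)"
          using elim z Pn by (intro sum_nonneg mult_nonneg_nonneg) (auto intro: less_imp_le)
        then show ?case by (simp add: E_def norm_exp_eq_Re)
      qed
    qed
    then have "AE y in distr (gamma_measure a \<Otimes>\<^sub>M D) (\<Pi>\<^sub>M i\<in>P. borel) T. norm (E y) \<le> 1"
      unfolding dT .
    then have "AE y in gamma_measure a \<Otimes>\<^sub>M D. norm (E (T y)) \<le> 1"
      by (subst (asm) AE_distr_iff) auto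
    then show "integrable (gamma_measure a \<Otimes>\<^sub>M D) (\<lambda>y. E (T y))"
      by (intro GD.integrable_const_bound [where B = 1]) auto
  qed
  also have "\<dots> = (\<integral>y. E y \<partial>(\<Pi>\<^sub>M i\<in>P. gamma_measure (p' i)))"
    unfolding dT [symmetric] by (rule integral_distr [symmetric]) measurable
  also have "\<dots> = (\<integral>y. (\<Prod>i\<in>P. exp (- (z i * of_real (y i)))) \<partial>(\<Pi>\<^sub>M i\<in>P. gamma_measure (p' i)))"
    unfolding E_def using fin by (simp add: exp_sum flip: sum_negf)
  also have "\<dots> = (\<Prod>i\<in>P. \<integral>r. exp (- (z i * of_real r)) \<partial>gamma_measure (p' i))"
  proof (rule GP.product_integral_prod [OF fin])
    fix i assume "i \<in> P"
    then have "-1 < Re (z i)" using z [of i] Pn by auto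
    then show "integrable (gamma_measure (p' i)) (\<lambda>r. exp (- (z i * of_real r)))"
      using integrable_gamma_cexp [OF p', of "z i" i 0] by simp
  qed
  also have "\<dots> = (\<Prod>i\<in>P. exp (- of_real (p i) * Ln (1 + z i)))"
  proof (rule prod.cong [OF refl])
    fix i assume i: "i \<in> P"
    then have "-1 < Re (z i)" using z [of i] Pn by auto
    with i show "(\<integral>r. exp (- (z i * of_real r)) \<partial>gamma_measure (p' i)) = exp (- of_real (p i) * Ln (1 + z i))"
      using gamma_laplace [OF p' [of i], of "z i"] by (simp add: p'_def)
  qed
  also have "\<dots> = (\<Prod>i\<le>n. exp (- of_real (p i) * Ln (1 + z i)))"
  proof (rule prod.mono_neutral_left)
    show "\<forall>i\<in>{..n} - P. exp (- of_real (p i) * Ln (1 + z i)) = 1"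
    proof
      fix i assume "i \<in> {..n} - P"
      then have "p i = 0" using p [of i] by (simp add: P_def)
      then show "exp (- of_real (p i) * Ln (1 + z i)) = 1" by simp
    qed
  qed (use Pn in auto)
  finally show ?thesis unfolding sumP a_def .
qed

lemma integral_finite_range:
  fixes f :: "'a \<Rightarrow> 'b" and g :: "'b \<Rightarrow> 'c :: {banach, second_countable_topology}"
  assumes "finite_measure \<nu>" and "finite I" and inj: "inj_on c I" and range: "\<And>x. x \<in> space \<nu> \<Longrightarrow> f x \<in> c ` I"
    and meas: "\<And>i. i \<in> I \<Longrightarrow> f -` {c i} \<inter> space \<nu> \<in> sets \<nu>"
  shows "(\<integral>x. g (f x) \<partial>\<nu>) = (\<Sum>i\<in>I. measure \<nu> (f -` {c i} \<inter> space \<nu>) *\<^sub>R g (c i))"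
proof -
  interpret finite_measure \<nu> by fact
  have "(\<integral>x. g (f x) \<partial>\<nu>) = (\<integral>x. (\<Sum>i\<in>I. indicator (f -` {c i} \<inter> space \<nu>) x *\<^sub>R g (c i)) \<partial>\<nu>)"
  proof (rule Bochner_Integration.integral_cong [OF refl])
    fix x assume x: "x \<in> space \<nu>"
    with range obtain k where k: "k \<in> I" "f x = c k" by blast
    have "(\<Sum>i\<in>I. indicator (f -` {c i} \<inter> space \<nu>) x *\<^sub>R g (c i)) = (\<Sum>i\<in>I. if i = k then g (c k) else 0)"
      using x k inj by (intro sum.cong) (auto simp: indicator_def inj_on_def)
    then show "g (f x) = (\<Sum>i\<in>I. indicator (f -` {c i} \<inter> space \<nu>) x *\<^sub>R g (c i))"
      using k \<open>finite I\<close> by simp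
  qed
  also have "\<dots> = (\<Sum>i\<in>I. measure \<nu> (f -` {c i} \<inter> space \<nu>) *\<^sub>R g (c i))"
    using meas by (subst Bochner_Integration.integral_sum) (auto simp: emeasure_eq_measure)
  finally show ?thesis .
qed

text \<open>
  The integrable majorant for the passage to the limit: the real part of the logarithm grows like
  \<open>ln (1 + \<bar>x\<bar>)\<close>, the imaginary part is bounded since \<open>1 + z y\<close> lies in the right half plane. The
  factor 2 accommodates simple approximations \<open>y\<close> of \<open>x\<close>.
\<close>

lemma norm_Ln_imaginary_le:
  fixes z :: complex and x y :: real
  assumes z: "Re z = 0" and y: "\<bar>y\<bar> \<le> 2 * \<bar>x\<bar>"
  shows "norm (Ln (1 + z * of_real y)) \<le> ln (1 + 2 * norm z) + ln (1 + \<bar>x\<bar>) + pi / 2"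
proof -
  let ?w = "1 + z * of_real y"
  have Re: "Re ?w = 1" using z by simp
  then have "?w \<noteq> 0" by (metis zero_complex.sel(1) zero_neq_one)
  have "1 \<le> norm ?w" using complex_Re_le_cmod [of ?w] by (simp only: Re)
  have "norm ?w \<le> 1 + norm z * \<bar>y\<bar>"
    using norm_triangle_ineq [of 1 "z * of_real y"] by (simp add: norm_mult)
  also have "\<dots> \<le> 1 + norm z * (2 * \<bar>x\<bar>)"
    using y by (intro add_left_mono mult_left_mono) auto
  also have "\<dots> \<le> (1 + 2 * norm z) * (1 + \<bar>x\<bar>)"
    by (simp add: algebra_simps)
  finally have "ln (norm ?w) \<le> ln ((1 + 2 * norm z) * (1 + \<bar>x\<bar>))"
    using \<open>1 \<le> norm ?w\<close> by (intro ln_mono) auto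
  also have "\<dots> = ln (1 + 2 * norm z) + ln (1 + \<bar>x\<bar>)"
    by (intro ln_mult_pos) (auto intro: add_pos_nonneg)
  finally have "\<bar>Re (Ln ?w)\<bar> \<le> ln (1 + 2 * norm z) + ln (1 + \<bar>x\<bar>)"
    using \<open>?w \<noteq> 0\<close> \<open>1 \<le> norm ?w\<close> by simp
  moreover have "\<bar>Im (Ln ?w)\<bar> < pi / 2"
    by (rule Re_Ln_pos_lt_imp) (simp only: Re zero_less_one)
  ultimately show ?thesis
    using cmod_le [of "Ln ?w"] by linarith
qed

section \<open>The mean of a Dirichlet process\<close>

locale dirichlet_mean =
  fixes a :: real and \<alpha> :: "real measure" and M :: "'w measure" and \<phi> :: "'w \<Rightarrow> real measure"
  assumes a_pos: "0 < a" and \<alpha>_F: "\<alpha> \<in> measures_F a" and process: "dirichlet_process M \<phi> \<alpha>"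
begin

lemma sets_\<alpha> [measurable_cong, simp]: "sets \<alpha> = sets borel"
  using \<alpha>_F by (simp add: measures_F_def)

lemma space_\<alpha> [simp]: "space \<alpha> = UNIV"
  using sets_eq_imp_space_eq [OF sets_\<alpha>] by simp

sublocale \<alpha>: finite_measure \<alpha>
  using \<alpha>_F by (simp add: measures_F_def)

sublocale M: prob_space M
  using process by (simp add: dirichlet_process_def)

sublocale G: prob_space "gamma_measure a"
  using a_pos by (rule prob_space_gamma_measure)

lemma measure_\<alpha>: "measure \<alpha> UNIV = a"
  using \<alpha>_F by (simp add: measures_F_def)

lemma integrable_log: "integrable \<alpha> (\<lambda>x. ln (1 + \<bar>x\<bar>))"
  using \<alpha>_F by (auto simp: measures_F_def integrable_iff_bounded)

lemma \<phi>_measurable [measurable]: "\<phi> \<in> measurable M (prob_algebra borel)"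
  using process by (simp add: dirichlet_process_def)

lemma \<phi>_measurable' [measurable]: "\<phi> \<in> measurable M (subprob_algebra borel)"
  using \<phi>_measurable by (rule measurable_prob_algebraD)

lemma \<phi>_space:
  assumes "\<omega> \<in> space M"
  shows "prob_space (\<phi> \<omega>)" "sets (\<phi> \<omega>) = sets borel" "space (\<phi> \<omega>) = UNIV"
proof -
  have "\<phi> \<omega> \<in> space (prob_algebra borel)"
    using \<phi>_measurable assms by (rule measurable_space)
  then show *: "prob_space (\<phi> \<omega>)" "sets (\<phi> \<omega>) = sets borel"
    by (auto simp: space_prob_algebra)
  show "space (\<phi> \<omega>) = UNIV" using sets_eq_imp_space_eq [OF *(2)] by simp
qed

lemma integral_\<phi>_measurable [measurable]:
  fixes f :: "real \<Rightarrow> 'b :: {banach, second_countable_topology}"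
  assumes "f \<in> borel_measurable borel"
  shows "(\<lambda>\<omega>. \<integral>x. f x \<partial>\<phi> \<omega>) \<in> borel_measurable M"
  using measurable_compose [OF \<phi>_measurable' integral_measurable_subprob_algebra [OF assms]] .

text \<open>
  The level sets of \<open>f\<close> form a finite partition, on which \<open>\<phi>\<close> is a Dirichlet vector.
\<close>

lemma laplace_simple_function:
  fixes f :: "real \<Rightarrow> real" and z :: complex
  assumes f [measurable]: "f \<in> borel_measurable borel" and fin: "finite (range f)"
    and z: "\<And>x. 0 \<le> Re (z * of_real (f x))"
  shows "(\<integral>s. \<integral>\<omega>. exp (- (of_real s * (z * of_real (\<integral>x. f x \<partial>\<phi> \<omega>)))) \<partial>M \<partial>gamma_measure a)
    = exp (- (\<integral>x. Ln (1 + z * of_real (f x)) \<partial>\<alpha>))"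
proof -
  define n where "n = card (range f) - 1"
  have "card (range f) \<noteq> 0" using fin by auto
  then have "{0..<card (range f)} = {..n}" by (auto simp: n_def)
  then obtain c where c: "bij_betw c {..n} (range f)"
    using ex_bij_betw_nat_finite [OF fin] by auto
  then have inj: "inj_on c {..n}" and img: "c ` {..n} = range f" by (auto simp: bij_betw_def)
  define C where "C i = f -` {c i}" for i
  have C [measurable]: "C i \<in> sets borel" for i
    using measurable_sets [OF f, of "{c i}"] by (simp add: C_def)
  have disj: "disjoint_family_on C {..n}"
    using inj by (auto simp: disjoint_family_on_def C_def inj_on_def)
  have union: "(\<Union>i\<le>n. C i) = UNIV"
  proof -
    have "x \<in> (\<Union>i\<le>n. C i)" for x
    proof -
      have "f x \<in> c ` {..n}" unfolding img by simp
      then show ?thesis by (auto simp: C_def)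
    qed
    then show ?thesis by blast
  qed
  have decomp: "(\<integral>x. g (f x) \<partial>\<nu>) = (\<Sum>i\<le>n. measure \<nu> (C i) *\<^sub>R g (c i))"
    if "finite_measure \<nu>" "sets \<nu> = sets borel"
    for \<nu> and g :: "real \<Rightarrow> 'b :: {banach, second_countable_topology}"
  proof -
    have "space \<nu> = UNIV" using sets_eq_imp_space_eq [OF that(2)] by simp
    then show ?thesis
      using integral_finite_range [OF that(1) finite_atMost inj, of f g] img C that(2)
      by (simp add: C_def)
  qed
  let ?p = "\<lambda>i. measure \<alpha> (C i)"
  let ?Y = "\<lambda>\<omega>. \<lambda>i\<in>{..<n}. measure (\<phi> \<omega>) (C i)"
  let ?F = "\<lambda>s x. exp (- (of_real s * ((\<Sum>i<n. (z * of_real (c i)) * of_real (x i))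
      + (z * of_real (c n)) * of_real (1 - (\<Sum>i<n. x i)))))"
  have law: "distr M (\<Pi>\<^sub>M i\<in>{..<n}. borel) ?Y = dirichlet n ?p"
    using process C disj union unfolding dirichlet_process_def by blast
  have Y [measurable]: "?Y \<in> measurable M (\<Pi>\<^sub>M i\<in>{..<n}. borel)"
    by (rule measurable_restrict) measurable
  have total: "(\<Sum>i\<le>n. ?p i) = a"
    using decomp [OF \<alpha>.finite_measure_axioms sets_\<alpha>, of "\<lambda>_. 1 :: real"] by (simp add: measure_\<alpha>)
  have F: "?F s (?Y \<omega>) = exp (- (of_real s * (z * of_real (\<integral>x. f x \<partial>\<phi> \<omega>))))"
    if "\<omega> \<in> space M" for s \<omega>
  proof -
    interpret P: prob_space "\<phi> \<omega>" using that by (rule \<phi>_space)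
    note dec = decomp [OF P.finite_measure_axioms \<phi>_space(2) [OF that]]
    have "(\<Sum>i\<le>n. measure (\<phi> \<omega>) (C i)) = 1"
      using dec [of "\<lambda>_. 1 :: real"] \<phi>_space(3) [OF that] P.prob_space by simp
    then have last: "1 - (\<Sum>i<n. ?Y \<omega> i) = measure (\<phi> \<omega>) (C n)"
      by (simp add: lessThan_Suc_atMost [symmetric])
    have "(\<Sum>i<n. (z * of_real (c i)) * of_real (?Y \<omega> i)) + (z * of_real (c n)) * of_real (1 - (\<Sum>i<n. ?Y \<omega> i))
        = (\<Sum>i\<le>n. (z * of_real (c i)) * of_real (measure (\<phi> \<omega>) (C i)))"
      unfolding last by (simp add: lessThan_Suc_atMost [symmetric])
    also have "\<dots> = z * of_real (\<Sum>i\<le>n. measure (\<phi> \<omega>) (C i) *\<^sub>R c i)"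
      by (simp add: sum_distrib_left mult_ac)
    also have "(\<Sum>i\<le>n. measure (\<phi> \<omega>) (C i) *\<^sub>R c i) = (\<integral>x. f x \<partial>\<phi> \<omega>)"
      using dec [of "\<lambda>y. y"] by simp
    finally show ?thesis by (simp only:)
  qed
  have zc: "0 \<le> Re (z * of_real (c i))" if "i \<le> n" for i
  proof -
    have "c i \<in> range f" using that img by blast
    then show ?thesis using z by (metis rangeE)
  qed
  have "(\<integral>s. \<integral>\<omega>. exp (- (of_real s * (z * of_real (\<integral>x. f x \<partial>\<phi> \<omega>)))) \<partial>M \<partial>gamma_measure a)
      = (\<integral>s. \<integral>\<omega>. ?F s (?Y \<omega>) \<partial>M \<partial>gamma_measure a)"
    by (intro Bochner_Integration.integral_cong refl) (simp only: F)
  also have "\<dots> = (\<integral>s. \<integral>x. ?F s x \<partial>dirichlet n ?p \<partial>gamma_measure a)"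
    unfolding law [symmetric]
    by (intro Bochner_Integration.integral_cong [OF refl] integral_distr [symmetric]) measurable
  also have "\<dots> = (\<Prod>i\<le>n. exp (- of_real (?p i) * Ln (1 + z * of_real (c i))))"
    using dirichlet_gamma_laplace [of n ?p "\<lambda>i. z * of_real (c i)"] a_pos zc
    unfolding total by simp
  also have "\<dots> = exp (- (\<Sum>i\<le>n. ?p i *\<^sub>R Ln (1 + z * of_real (c i))))"
    by (simp add: exp_sum scaleR_conv_of_real flip: sum_negf)
  also have "(\<Sum>i\<le>n. ?p i *\<^sub>R Ln (1 + z * of_real (c i))) = (\<integral>x. Ln (1 + z * of_real (f x)) \<partial>\<alpha>)"
    using decomp [OF \<alpha>.finite_measure_axioms sets_\<alpha>, of "\<lambda>y. Ln (1 + z * of_real y)"] by simp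
  finally show ?thesis .
qed

lemma real_laplace_simple_function:
  fixes f :: "real \<Rightarrow> real" and t :: real
  assumes f [measurable]: "f \<in> borel_measurable borel" and fin: "finite (range f)"
    and nonneg: "\<And>x. 0 \<le> f x" and t: "0 \<le> t"
  shows "(\<integral>s. \<integral>\<omega>. exp (- (s * (t * (\<integral>x. f x \<partial>\<phi> \<omega>)))) \<partial>M \<partial>gamma_measure a)
    = exp (- (\<integral>x. ln (1 + t * f x) \<partial>\<alpha>))"
proof -
  have Ln: "Ln (1 + of_real t * of_real (f x)) = of_real (ln (1 + t * f x))" for x
  proof -
    have "0 < 1 + t * f x" using t nonneg [of x] by (simp add: add_pos_nonneg)
    then have "Ln (of_real (1 + t * f x)) = of_real (ln (1 + t * f x))" by (rule Ln_of_real)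
    then show ?thesis by simp
  qed
  have "complex_of_real (\<integral>s. \<integral>\<omega>. exp (- (s * (t * (\<integral>x. f x \<partial>\<phi> \<omega>)))) \<partial>M \<partial>gamma_measure a)
     = (\<integral>s. \<integral>\<omega>. exp (- (of_real s * (of_real t * of_real (\<integral>x. f x \<partial>\<phi> \<omega>)))) \<partial>M \<partial>gamma_measure a)"
    by (simp flip: integral_complex_of_real exp_of_real)
  also have "\<dots> = exp (- (\<integral>x. Ln (1 + of_real t * of_real (f x)) \<partial>\<alpha>))"
    using t nonneg by (intro laplace_simple_function f fin) simp
  also have "\<dots> = of_real (exp (- (\<integral>x. ln (1 + t * f x) \<partial>\<alpha>)))"
    unfolding Ln by (simp flip: exp_of_real)
  finally show ?thesis by (simp only: of_real_eq_iff)
qed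

lemma borel_measurable_\<phi>:
  assumes "\<omega> \<in> space M" "f \<in> borel_measurable borel"
  shows "f \<in> borel_measurable (\<phi> \<omega>)"
  using assms measurable_cong_sets [OF \<phi>_space(2) [OF assms(1)] refl] by blast

text \<open>
  Let \<open>B\<close> be the event that \<open>\<integral>\<bar>x\<bar> d\<phi>\<close> is infinite and let \<open>f k\<close> be simple functions increasing to \<open>\<bar>x\<bar>\<close>.
  On \<open>B\<close> the variables \<open>exp (- s t \<integral>f k d\<phi>)\<close> tend to zero, so their Laplace transforms are
  asymptotically at most the probability of the complement of \<open>B\<close>. By the formula for simple functions they
  are at least \<open>exp (- \<integral> ln (1 + t \<bar>x\<bar>) d\<alpha>)\<close>, which tends to 1 as \<open>t \<rightarrow> 0\<close> thanks to the logarithmic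
  moment of \<open>\<alpha>\<close>.
\<close>

lemma AE_integrable: "AE \<omega> in M. integrable (\<phi> \<omega>) (\<lambda>x. x)"
proof -
  define J where "J \<omega> = (\<integral>\<^sup>+ x. ennreal \<bar>x\<bar> \<partial>\<phi> \<omega>)" for \<omega>
  have J [measurable]: "J \<in> borel_measurable M"
    unfolding J_def [abs_def]
    by (rule measurable_compose [OF \<phi>_measurable' nn_integral_measurable_subprob_algebra]) measurable
  define B where "B = {\<omega> \<in> space M. J \<omega> = \<infinity>}"
  have B [measurable]: "B \<in> sets M" unfolding B_def by measurable
  obtain f :: "nat \<Rightarrow> real \<Rightarrow> real" where f: "incseq f" "\<And>i. simple_function borel (f i)"
    "\<And>x. bdd_above (range (\<lambda>i. f i x))" "\<And>i x. 0 \<le> f i x" "(\<lambda>x. \<bar>x\<bar>) = (SUP i. f i)"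
    using borel_measurable_implies_simple_function_sequence_real [of "\<lambda>x::real. \<bar>x\<bar>" borel]
    by auto
  have f_meas [measurable]: "f i \<in> borel_measurable borel" for i
    using f(2) by (rule borel_measurable_simple_function)
  have f_fin: "finite (range (f i))" for i
    using simple_functionD(1) [OF f(2), of i] by simp
  have f_sup: "\<bar>x\<bar> = (SUP i. f i x)" for x
    using fun_cong [OF f(5), of x] by (simp add: image_comp comp_def SUP_apply)
  have f_le: "f i x \<le> \<bar>x\<bar>" for i x
    unfolding f_sup using f(3) by (rule cSUP_upper [OF UNIV_I])
  have f_mono: "incseq (\<lambda>i. f i x)" for x
    using f(1) by (auto simp: incseq_def le_fun_def)
  have f_lim: "(\<lambda>i. f i x) \<longlonglongrightarrow> \<bar>x\<bar>" for x
    unfolding f_sup using f(3) f_mono by (rule LIMSEQ_incseq_SUP)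
  define T where "T k \<omega> = (\<integral>x. f k x \<partial>\<phi> \<omega>)" for k \<omega>
  have T_meas [measurable]: "T k \<in> borel_measurable M" for k
    unfolding T_def [abs_def] by measurable
  have T_nonneg: "0 \<le> T k \<omega>" for k \<omega>
    unfolding T_def using f(4) by (intro integral_nonneg_AE) auto
  have T_top: "filterlim (\<lambda>k. T k \<omega>) at_top sequentially" if \<omega>: "\<omega> \<in> B" for \<omega>
  proof -
    have sp: "\<omega> \<in> space M" using \<omega> by (simp add: B_def)
    interpret P: prob_space "\<phi> \<omega>" using sp by (rule \<phi>_space)
    note meas = borel_measurable_\<phi> [OF sp]
    have "ennreal (T k \<omega>) = (\<integral>\<^sup>+ x. ennreal (f k x) \<partial>\<phi> \<omega>)" for k
    proof -
      have "\<bar>f k x\<bar> \<le> Max (range (f k))" for x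
        using f(4) [of k x] Max_ge [OF f_fin, of "f k x" k] by simp
      then have "integrable (\<phi> \<omega>) (f k)"
        by (intro P.integrable_const_bound [where B = "Max (range (f k))"] AE_I2 meas f_meas) simp
      then show ?thesis
        unfolding T_def using f(4) by (intro nn_integral_eq_integral [symmetric] AE_I2)
    qed
    moreover have "(\<lambda>k. \<integral>\<^sup>+ x. ennreal (f k x) \<partial>\<phi> \<omega>) \<longlonglongrightarrow> (\<integral>\<^sup>+ x. ennreal \<bar>x\<bar> \<partial>\<phi> \<omega>)"
    proof (rule nn_integral_LIMSEQ)
      show "incseq (\<lambda>k x. ennreal (f k x))"
        using f_mono by (auto simp: incseq_def le_fun_def intro: ennreal_leI)
      show "(\<lambda>k. ennreal (f k x)) \<longlonglongrightarrow> ennreal \<bar>x\<bar>" for x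
        using f_lim [of x] by (rule tendsto_ennrealI)
    qed (intro meas, measurable)
    moreover have "(\<integral>\<^sup>+ x. ennreal \<bar>x\<bar> \<partial>\<phi> \<omega>) = top"
      using \<omega> by (simp add: B_def J_def)
    ultimately have "(\<lambda>k. ennreal (T k \<omega>)) \<longlonglongrightarrow> top" by simp
    then show ?thesis by (simp only: ennreal_tendsto_top_eq_at_top)
  qed
  have int_log: "integrable \<alpha> (\<lambda>x. ln (1 + t * \<bar>x\<bar>))" if "0 \<le> t" "t \<le> 1" for t
  proof (rule Bochner_Integration.integrable_bound [OF integrable_log])
    have "\<bar>ln (1 + t * \<bar>x\<bar>)\<bar> \<le> \<bar>ln (1 + \<bar>x\<bar>)\<bar>" for x
    proof -
      have "t * \<bar>x\<bar> \<le> 1 * \<bar>x\<bar>" using that by (intro mult_right_mono) auto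
      moreover have "0 \<le> t * \<bar>x\<bar>" using that by simp
      ultimately show ?thesis by simp
    qed
    then show "AE x in \<alpha>. norm (ln (1 + t * \<bar>x\<bar>)) \<le> norm (ln (1 + \<bar>x\<bar>))" by simp
  qed measurable
  have bound: "exp (- (\<integral>x. ln (1 + t * \<bar>x\<bar>) \<partial>\<alpha>)) \<le> 1 - M.prob B" if t: "0 < t" "t \<le> 1" for t
  proof (rule LIMSEQ_le_const)
    let ?E = "\<lambda>k s \<omega>. exp (- (s * (t * T k \<omega>)))"
    let ?R = "\<lambda>k. \<integral>s. \<integral>\<omega>. indicator B \<omega> * ?E k s \<omega> \<partial>M \<partial>gamma_measure a"
    have E_le: "?E k s \<omega> \<le> 1" if "0 < s" for k s \<omega>
      using that t T_nonneg by simp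
    have intE: "integrable M (?E k s)" "integrable M (\<lambda>\<omega>. indicator B \<omega> * ?E k s \<omega>)"
      if s: "0 < s" for k s
    proof -
      show "integrable M (?E k s)"
        using E_le [OF s] by (intro M.integrable_const_bound [where B = 1]) auto
      show "integrable M (\<lambda>\<omega>. indicator B \<omega> * ?E k s \<omega>)"
        using E_le [OF s] by (intro M.integrable_const_bound [where B = 1]) (auto simp: indicator_def)
    qed
    have R_le: "\<bar>\<integral>\<omega>. indicator B \<omega> * ?E k s \<omega> \<partial>M\<bar> \<le> 1" if s: "0 < s" for k s
    proof -
      have "\<bar>\<integral>\<omega>. indicator B \<omega> * ?E k s \<omega> \<partial>M\<bar> = (\<integral>\<omega>. indicator B \<omega> * ?E k s \<omega> \<partial>M)"
        by (intro abs_of_nonneg integral_nonneg_AE) auto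
      also have "\<dots> \<le> (\<integral>\<omega>. 1 \<partial>M)"
        using E_le [OF s] intE [OF s] by (intro integral_mono) (auto simp: indicator_def)
      finally show ?thesis using M.prob_space by simp
    qed
    have R_meas: "(\<lambda>s. \<integral>\<omega>. indicator B \<omega> * ?E k s \<omega> \<partial>M) \<in> borel_measurable (gamma_measure a)" for k
      by measurable
    have R_int: "integrable (gamma_measure a) (\<lambda>s. \<integral>\<omega>. indicator B \<omega> * ?E k s \<omega> \<partial>M)" for k
    proof (rule G.integrable_const_bound [where B = 1])
      show "AE s in gamma_measure a. norm (\<integral>\<omega>. indicator B \<omega> * ?E k s \<omega> \<partial>M) \<le> 1"
        using AE_gamma_measure_pos by eventually_elim (use R_le in auto)
    qed (rule R_meas)
    have lim: "?R \<longlonglongrightarrow> (\<integral>s. 0 \<partial>gamma_measure a)"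
    proof (rule integral_dominated_convergence [where w = "\<lambda>_. 1"])
      show "AE s in gamma_measure a. (\<lambda>k. \<integral>\<omega>. indicator B \<omega> * ?E k s \<omega> \<partial>M) \<longlonglongrightarrow> 0"
        using AE_gamma_measure_pos
      proof eventually_elim
        case (elim s)
        have "(\<lambda>k. \<integral>\<omega>. indicator B \<omega> * ?E k s \<omega> \<partial>M) \<longlonglongrightarrow> (\<integral>\<omega>. 0 \<partial>M)"
        proof (rule integral_dominated_convergence [where w = "\<lambda>_. 1"])
          have "(\<lambda>k. indicator B \<omega> * ?E k s \<omega>) \<longlonglongrightarrow> 0" for \<omega>
          proof (cases "\<omega> \<in> B")
            case True
            have "filterlim (\<lambda>k. (s * t) * T k \<omega>) at_top sequentially"
              using elim t T_top [OF True] by (intro filterlim_tendsto_pos_mult_at_top [OF tendsto_const]) auto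
            then have "(\<lambda>k. exp (- ((s * t) * T k \<omega>))) \<longlonglongrightarrow> 0"
              by (intro filterlim_compose [OF exp_at_bot]) (simp add: filterlim_uminus_at_top)
            then show ?thesis using True by (simp add: mult.assoc)
          qed simp
          then show "AE \<omega> in M. (\<lambda>k. indicator B \<omega> * ?E k s \<omega>) \<longlonglongrightarrow> 0" by simp
          show "AE \<omega> in M. norm (indicator B \<omega> * ?E k s \<omega>) \<le> 1" for k
            using E_le [OF elim] by (auto simp: indicator_def)
        qed auto
        then show ?case by simp
      qed
      show "AE s in gamma_measure a. norm (\<integral>\<omega>. indicator B \<omega> * ?E k s \<omega> \<partial>M) \<le> 1" for k
        using AE_gamma_measure_pos by eventually_elim (use R_le in auto)
    qed (use R_meas in auto)
    then show "(\<lambda>k. (1 - M.prob B) + ?R k) \<longlonglongrightarrow> 1 - M.prob B"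
      by (intro tendsto_eq_intros) auto
    have "exp (- (\<integral>x. ln (1 + t * \<bar>x\<bar>) \<partial>\<alpha>)) \<le> (1 - M.prob B) + ?R k" for k
    proof -
      have ln_mono: "0 \<le> ln (1 + t * f k x)" "ln (1 + t * f k x) \<le> ln (1 + t * \<bar>x\<bar>)" for x
      proof -
        have "t * f k x \<le> t * \<bar>x\<bar>" "0 \<le> t * f k x"
          using t f_le [of k x] f(4) [of k x] by auto
        then show "0 \<le> ln (1 + t * f k x)" "ln (1 + t * f k x) \<le> ln (1 + t * \<bar>x\<bar>)" by auto
      qed
      have "(\<integral>x. ln (1 + t * f k x) \<partial>\<alpha>) \<le> (\<integral>x. ln (1 + t * \<bar>x\<bar>) \<partial>\<alpha>)"
        using int_log [of t] t ln_mono
        by (intro integral_mono Bochner_Integration.integrable_bound [OF int_log [of t]])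
           (auto intro!: AE_I2 simp: abs_of_nonneg intro: order_trans)
      then have "exp (- (\<integral>x. ln (1 + t * \<bar>x\<bar>) \<partial>\<alpha>)) \<le> exp (- (\<integral>x. ln (1 + t * f k x) \<partial>\<alpha>))"
        by simp
      also have "\<dots> = (\<integral>s. \<integral>\<omega>. ?E k s \<omega> \<partial>M \<partial>gamma_measure a)"
        unfolding T_def using t f(4)
        by (intro real_laplace_simple_function [symmetric] f_fin) auto
      also have "\<dots> \<le> (\<integral>s. (1 - M.prob B) + (\<integral>\<omega>. indicator B \<omega> * ?E k s \<omega> \<partial>M) \<partial>gamma_measure a)"
      proof (rule integral_mono_AE)
        have *: "(\<integral>\<omega>. ?E k s \<omega> \<partial>M) \<le> (1 - M.prob B) + (\<integral>\<omega>. indicator B \<omega> * ?E k s \<omega> \<partial>M)"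
          if s: "0 < s" for s
        proof -
          have intI: "integrable M (indicator (space M - B) :: _ \<Rightarrow> real)"
            by (rule M.integrable_const_bound [where B = 1]) auto
          have "(\<integral>\<omega>. ?E k s \<omega> \<partial>M) \<le> (\<integral>\<omega>. indicator (space M - B) \<omega> + indicator B \<omega> * ?E k s \<omega> \<partial>M)"
          proof (rule integral_mono)
            show "integrable M (\<lambda>\<omega>. indicator (space M - B) \<omega> + indicator B \<omega> * ?E k s \<omega>)"
              using intI intE(2) [OF s] by (rule Bochner_Integration.integrable_add)
          qed (use intE [OF s] E_le [OF s] in \<open>auto simp: indicator_def\<close>)
          also have "\<dots> = M.prob (space M - B) + (\<integral>\<omega>. indicator B \<omega> * ?E k s \<omega> \<partial>M)"
            using intI intE [OF s] by (subst Bochner_Integration.integral_add) auto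
          finally show ?thesis by (simp add: M.prob_compl)
        qed
        show "AE s in gamma_measure a. (\<integral>\<omega>. ?E k s \<omega> \<partial>M) \<le>
            (1 - M.prob B) + (\<integral>\<omega>. indicator B \<omega> * ?E k s \<omega> \<partial>M)"
          using AE_gamma_measure_pos by eventually_elim (rule *)
        show "integrable (gamma_measure a) (\<lambda>s. \<integral>\<omega>. ?E k s \<omega> \<partial>M)"
        proof (rule G.integrable_const_bound [where B = 1])
          show "AE s in gamma_measure a. norm (\<integral>\<omega>. ?E k s \<omega> \<partial>M) \<le> 1"
            using AE_gamma_measure_pos
          proof eventually_elim
            case (elim s)
            have "norm (\<integral>\<omega>. ?E k s \<omega> \<partial>M) \<le> (\<integral>\<omega>. norm (?E k s \<omega>) \<partial>M)" by (rule integral_norm_bound)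
            also have "\<dots> \<le> (\<integral>\<omega>. 1 \<partial>M)"
              using E_le [OF elim] intE [OF elim] by (intro integral_mono) auto
            finally show ?case using M.prob_space by simp
          qed
        qed measurable
        show "integrable (gamma_measure a) (\<lambda>s. (1 - M.prob B) + (\<integral>\<omega>. indicator B \<omega> * ?E k s \<omega> \<partial>M))"
          using R_int by (intro Bochner_Integration.integrable_add G.integrable_const)
      qed
      also have "\<dots> = (1 - M.prob B) + ?R k"
        using R_int G.prob_space by (subst Bochner_Integration.integral_add) auto
      finally show ?thesis .
    qed
    then show "\<exists>N. \<forall>k\<ge>N. exp (- (\<integral>x. ln (1 + t * \<bar>x\<bar>) \<partial>\<alpha>)) \<le> (1 - M.prob B) + ?R k"
      by blast
  qed
  have "(\<lambda>m. \<integral>x. ln (1 + inverse (real (Suc m)) * \<bar>x\<bar>) \<partial>\<alpha>) \<longlonglongrightarrow> (\<integral>x. 0 \<partial>\<alpha>)"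
  proof (rule integral_dominated_convergence [OF _ _ integrable_log])
    have "(\<lambda>m. ln (1 + inverse (real (Suc m)) * \<bar>x\<bar>)) \<longlonglongrightarrow> ln (1 + 0 * \<bar>x\<bar>)" for x
      by (intro tendsto_intros LIMSEQ_inverse_real_of_nat) auto
    then show "AE x in \<alpha>. (\<lambda>m. ln (1 + inverse (real (Suc m)) * \<bar>x\<bar>)) \<longlonglongrightarrow> 0" by simp
    have "\<bar>ln (1 + inverse (real (Suc m)) * \<bar>x\<bar>)\<bar> \<le> ln (1 + \<bar>x\<bar>)" for m x
    proof -
      have "inverse (real (Suc m)) * \<bar>x\<bar> \<le> 1 * \<bar>x\<bar>"
        by (intro mult_right_mono) (auto simp: inverse_le_1_iff)
      moreover have "0 \<le> inverse (real (Suc m)) * \<bar>x\<bar>" by simp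
      moreover have "\<bar>ln (1 + y)\<bar> \<le> ln (1 + \<bar>x\<bar>)" if "y \<le> 1 * \<bar>x\<bar>" "0 \<le> y" for y
        using that by simp
      ultimately show ?thesis by blast
    qed
    then show "AE x in \<alpha>. norm (ln (1 + inverse (real (Suc m)) * \<bar>x\<bar>)) \<le> ln (1 + \<bar>x\<bar>)" for m by simp
  qed auto
  then have "(\<lambda>m. exp (- (\<integral>x. ln (1 + inverse (real (Suc m)) * \<bar>x\<bar>) \<partial>\<alpha>))) \<longlonglongrightarrow> exp (- 0)"
    by (intro tendsto_intros) simp
  then have "exp (- 0) \<le> 1 - M.prob B"
    by (rule LIMSEQ_le_const2)
       (intro exI allI impI bound, auto simp: inverse_le_1_iff simp del: of_nat_Suc)
  then have "M.prob B = 0" using measure_nonneg [of M B] by simp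
  then have "emeasure M B = 0" by (simp add: M.emeasure_eq_measure)
  then have "AE \<omega> in M. J \<omega> \<noteq> \<infinity>"
    using B by (intro AE_I [of _ _ B]) (auto simp: B_def)
  then show ?thesis
  proof (rule AE_mp, intro AE_I2 impI)
    fix \<omega> assume \<omega>: "\<omega> \<in> space M" "J \<omega> \<noteq> \<infinity>"
    show "integrable (\<phi> \<omega>) (\<lambda>x. x)"
      unfolding integrable_iff_bounded
      using \<omega>(2) by (auto simp: J_def less_top intro!: borel_measurable_\<phi> [OF \<omega>(1)])
  qed
qed

text \<open>
  The Cifarelli--Regazzini identity. Simple functions \<open>g k\<close> tend to \<open>x\<close> with \<open>\<bar>g k x\<bar> \<le> 2 \<bar>x\<bar>\<close>; on the left
  the exponentials have modulus one and the means converge almost surely since \<open>\<phi>\<close> integrates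
  \<open>\<bar>x\<bar>\<close>, on the right the logarithmic moment of \<open>\<alpha>\<close> dominates.
\<close>

lemma mean_transform:
  fixes z :: complex
  assumes z: "Re z = 0"
  shows "(\<integral>s. \<integral>\<omega>. exp (- (of_real s * (z * of_real (\<integral>x. x \<partial>\<phi> \<omega>)))) \<partial>M \<partial>gamma_measure a)
    = exp (- (\<integral>x. Ln (1 + z * of_real x) \<partial>\<alpha>))"
proof -
  obtain g :: "nat \<Rightarrow> real \<Rightarrow> real" where g: "\<And>k. simple_function borel (g k)"
    "\<And>x. (\<lambda>k. g k x) \<longlonglongrightarrow> x" "\<And>k x. \<bar>g k x\<bar> \<le> 2 * \<bar>x\<bar>"
    using borel_measurable_implies_sequence_metric [of "\<lambda>x::real. x" borel 0] by auto
  have g_meas [measurable]: "g k \<in> borel_measurable borel" for k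
    using g(1) by (rule borel_measurable_simple_function)
  have g_fin: "finite (range (g k))" for k
    using simple_functionD(1) [OF g(1), of k] by simp
  let ?E = "\<lambda>s m. exp (- (of_real s * (z * of_real m))) :: complex"
  have E1: "norm (?E s m) = 1" for s m using z by (simp add: norm_exp_eq_Re)
  let ?X = "\<lambda>\<omega>. \<integral>x. x \<partial>\<phi> \<omega>"
  let ?Xk = "\<lambda>k \<omega>. \<integral>x. g k x \<partial>\<phi> \<omega>"
  have X_lim: "AE \<omega> in M. (\<lambda>k. ?Xk k \<omega>) \<longlonglongrightarrow> ?X \<omega>"
  proof (rule AE_mp [OF AE_integrable], intro AE_I2 impI)
    fix \<omega> assume \<omega>: "\<omega> \<in> space M" "integrable (\<phi> \<omega>) (\<lambda>x. x)"
    note meas = borel_measurable_\<phi> [OF \<omega>(1)]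
    show "(\<lambda>k. ?Xk k \<omega>) \<longlonglongrightarrow> ?X \<omega>"
    proof (rule integral_dominated_convergence [where w = "\<lambda>x. 2 * \<bar>x\<bar>"])
      show "integrable (\<phi> \<omega>) (\<lambda>x. 2 * \<bar>x\<bar>)" using \<omega>(2) by simp
    qed (use g in \<open>auto intro!: meas\<close>)
  qed
  have inner: "(\<lambda>k. \<integral>\<omega>. ?E s (?Xk k \<omega>) \<partial>M) \<longlonglongrightarrow> (\<integral>\<omega>. ?E s (?X \<omega>) \<partial>M)" for s
  proof (rule integral_dominated_convergence [where w = "\<lambda>_. 1"])
    show "AE \<omega> in M. (\<lambda>k. ?E s (?Xk k \<omega>)) \<longlonglongrightarrow> ?E s (?X \<omega>)"
      using X_lim by eventually_elim (intro tendsto_intros)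
  qed (simp_all only: E1, simp_all)
  have outer: "(\<lambda>k. \<integral>s. \<integral>\<omega>. ?E s (?Xk k \<omega>) \<partial>M \<partial>gamma_measure a) \<longlonglongrightarrow>
      (\<integral>s. \<integral>\<omega>. ?E s (?X \<omega>) \<partial>M \<partial>gamma_measure a)"
  proof (rule integral_dominated_convergence [where w = "\<lambda>_. 1"])
    show "AE s in gamma_measure a. (\<lambda>k. \<integral>\<omega>. ?E s (?Xk k \<omega>) \<partial>M) \<longlonglongrightarrow> (\<integral>\<omega>. ?E s (?X \<omega>) \<partial>M)"
      using inner by simp
    have "norm (\<integral>\<omega>. ?E s (?Xk k \<omega>) \<partial>M) \<le> 1" for s k
      using integral_norm_bound [of M "\<lambda>\<omega>. ?E s (?Xk k \<omega>)"] M.prob_space by (simp only: E1) simp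
    then show "AE s in gamma_measure a. norm (\<integral>\<omega>. ?E s (?Xk k \<omega>) \<partial>M) \<le> 1" for k by simp
  qed auto
  have "(\<lambda>k. \<integral>x. Ln (1 + z * of_real (g k x)) \<partial>\<alpha>) \<longlonglongrightarrow> (\<integral>x. Ln (1 + z * of_real x) \<partial>\<alpha>)"
  proof (rule integral_dominated_convergence
      [where w = "\<lambda>x. ln (1 + 2 * norm z) + ln (1 + \<bar>x\<bar>) + pi / 2"])
    show "integrable \<alpha> (\<lambda>x. ln (1 + 2 * norm z) + ln (1 + \<bar>x\<bar>) + pi / 2)"
      using integrable_log by simp
    have "(\<lambda>k. Ln (1 + z * of_real (g k x))) \<longlonglongrightarrow> Ln (1 + z * of_real x)" for x
    proof (intro tendsto_intros g(2))
      show "1 + z * of_real x \<notin> \<real>\<^sub>\<le>\<^sub>0"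
        using z by (simp add: complex_nonpos_Reals_iff)
    qed
    then show "AE x in \<alpha>. (\<lambda>k. Ln (1 + z * of_real (g k x))) \<longlonglongrightarrow> Ln (1 + z * of_real x)" by simp
    show "AE x in \<alpha>. norm (Ln (1 + z * of_real (g k x))) \<le> ln (1 + 2 * norm z) + ln (1 + \<bar>x\<bar>) + pi / 2" for k
      using norm_Ln_imaginary_le [OF z g(3)] by simp
  qed measurable
  then have "(\<lambda>k. exp (- (\<integral>x. Ln (1 + z * of_real (g k x)) \<partial>\<alpha>))) \<longlonglongrightarrow>
      exp (- (\<integral>x. Ln (1 + z * of_real x) \<partial>\<alpha>))"
    by (intro tendsto_intros)
  moreover have "exp (- (\<integral>x. Ln (1 + z * of_real (g k x)) \<partial>\<alpha>)) =
      (\<integral>s. \<integral>\<omega>. ?E s (?Xk k \<omega>) \<partial>M \<partial>gamma_measure a)" for k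
    using z by (intro laplace_simple_function [symmetric] g_meas g_fin) simp
  ultimately show ?thesis
    using outer LIMSEQ_unique by (simp only:) blast
qed

lemma sets_mean_distribution [simp]: "sets (mean_distribution M \<phi>) = sets borel"
  by (simp add: mean_distribution_def)

lemma prob_space_mean_distribution: "prob_space (mean_distribution M \<phi>)"
  unfolding mean_distribution_def by (rule M.prob_space_distr) measurable

text \<open>
  The imaginary part of the preceding identity at \<open>z = - \<i> t\<close>, where
  \<open>Ln (1 - \<i> y) = ln \<bar>1 - \<i> y\<bar> - \<i> arctan y\<close>. Only the sine factor on the right can vanish.
\<close>

lemma mean_sine_transform:
  "(\<integral>s. sine_transform (mean_distribution M \<phi>) (t * s) \<partial>gamma_measure a) =
     exp (- (\<integral>x. ln (norm (1 - \<i> * of_real (t * x))) \<partial>\<alpha>)) * sin (\<integral>x. arctan (t * x) \<partial>\<alpha>)"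
proof -
  let ?z = "- \<i> * of_real t"
  let ?E = "\<lambda>s \<omega>. exp (- (of_real s * (?z * of_real (\<integral>x. x \<partial>\<phi> \<omega>))))"
  have z: "Re ?z = 0" by simp
  have E1: "norm (?E s \<omega>) = 1" for s \<omega> by (simp add: norm_exp_eq_Re)
  have intE: "integrable M (?E s)" for s
    by (rule M.integrable_const_bound [where B = 1]) (simp only: E1, simp, measurable)
  have "norm (\<integral>\<omega>. ?E s \<omega> \<partial>M) \<le> 1" for s
    using integral_norm_bound [of M "?E s"] M.prob_space by (simp only: E1) simp
  then have intG: "integrable (gamma_measure a) (\<lambda>s. \<integral>\<omega>. ?E s \<omega> \<partial>M)"
    by (intro G.integrable_const_bound [where B = 1] AE_I2) measurable
  have "sine_transform (mean_distribution M \<phi>) (t * s) = Im (\<integral>\<omega>. ?E s \<omega> \<partial>M)" for s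
  proof -
    have "sine_transform (mean_distribution M \<phi>) (t * s) = (\<integral>\<omega>. sin (t * s * (\<integral>x. x \<partial>\<phi> \<omega>)) \<partial>M)"
      unfolding sine_transform_def mean_distribution_def by (rule integral_distr) measurable
    also have "\<dots> = (\<integral>\<omega>. Im (?E s \<omega>) \<partial>M)"
      by (simp add: Im_exp mult_ac)
    also have "\<dots> = Im (\<integral>\<omega>. ?E s \<omega> \<partial>M)" using intE by (rule integral_Im)
    finally show ?thesis .
  qed
  then have "(\<integral>s. sine_transform (mean_distribution M \<phi>) (t * s) \<partial>gamma_measure a) =
      (\<integral>s. Im (\<integral>\<omega>. ?E s \<omega> \<partial>M) \<partial>gamma_measure a)" by (simp only:)
  also have "\<dots> = Im (\<integral>s. \<integral>\<omega>. ?E s \<omega> \<partial>M \<partial>gamma_measure a)"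
    using intG by (rule integral_Im)
  also have "\<dots> = Im (exp (- (\<integral>x. Ln (1 + ?z * of_real x) \<partial>\<alpha>)))"
    unfolding mean_transform [OF z] ..
  also have "\<dots> = exp (- Re (\<integral>x. Ln (1 + ?z * of_real x) \<partial>\<alpha>)) * sin (- Im (\<integral>x. Ln (1 + ?z * of_real x) \<partial>\<alpha>))"
    by (simp only: Im_exp uminus_complex.sel)
  finally have eq: "(\<integral>s. sine_transform (mean_distribution M \<phi>) (t * s) \<partial>gamma_measure a) = \<dots>" .
  have "Re (\<integral>x. Ln (1 + ?z * of_real x) \<partial>\<alpha>) = (\<integral>x. ln (norm (1 - \<i> * of_real (t * x))) \<partial>\<alpha>)"
    and "- Im (\<integral>x. Ln (1 + ?z * of_real x) \<partial>\<alpha>) = (\<integral>x. arctan (t * x) \<partial>\<alpha>)"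
  proof -
    have int: "integrable \<alpha> (\<lambda>x. Ln (1 + ?z * of_real x))"
    proof (rule Bochner_Integration.integrable_bound)
      show "integrable \<alpha> (\<lambda>x. ln (1 + 2 * norm ?z) + ln (1 + \<bar>x\<bar>) + pi / 2)"
        using integrable_log by simp
      show "AE x in \<alpha>. norm (Ln (1 + ?z * of_real x)) \<le> norm (ln (1 + 2 * norm ?z) + ln (1 + \<bar>x\<bar>) + pi / 2)"
        using norm_Ln_imaginary_le [OF z] by (intro AE_I2 order_trans [OF _ abs_ge_self, folded real_norm_def]) simp
    qed measurable
    have Ln: "Re (Ln (1 + ?z * of_real x)) = ln (norm (1 - \<i> * of_real (t * x)))"
      "Im (Ln (1 + ?z * of_real x)) = - arctan (t * x)" for x
    proof -
      have "Re (1 + ?z * of_real x) = 1" by simp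
      then have "1 + ?z * of_real x \<noteq> 0" by (metis zero_complex.sel(1) zero_neq_one)
      then show "Re (Ln (1 + ?z * of_real x)) = ln (norm (1 - \<i> * of_real (t * x)))"
        "Im (Ln (1 + ?z * of_real x)) = - arctan (t * x)"
        by (simp_all add: Im_Ln_eq arctan_minus mult.assoc)
    qed
    show "Re (\<integral>x. Ln (1 + ?z * of_real x) \<partial>\<alpha>) = (\<integral>x. ln (norm (1 - \<i> * of_real (t * x))) \<partial>\<alpha>)"
      unfolding integral_Re [OF int, symmetric] Ln ..
    show "- Im (\<integral>x. Ln (1 + ?z * of_real x) \<partial>\<alpha>) = (\<integral>x. arctan (t * x) \<partial>\<alpha>)"
      unfolding integral_Im [OF int, symmetric] Ln by simp
  qed
  with eq show ?thesis by (simp only:)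
qed

end

section \<open>Symmetry of the mean\<close>

theorem theorem8:
  fixes a :: real and \<alpha> :: "real measure"
    and M :: "'w measure" and \<phi> :: "'w \<Rightarrow> real measure"
  assumes "0 < a" and "\<alpha> \<in> measures_F a"
    and "dirichlet_process M \<phi> \<alpha>"
  shows "symmetric_measure (mean_distribution M \<phi>) \<longleftrightarrow> symmetric_measure \<alpha>"
proof -
  interpret dirichlet_mean a \<alpha> M \<phi>
    using assms by unfold_locales
  let ?\<theta> = "\<lambda>t. \<integral>x. arctan (t * x) \<partial>\<alpha>"
  interpret \<mu>: prob_space "mean_distribution M \<phi>"
    by (rule prob_space_mean_distribution)
  have "space (mean_distribution M \<phi>) = UNIV" by (simp add: mean_distribution_def)
  then have \<mu>_pos: "0 < measure (mean_distribution M \<phi>) UNIV"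
    using \<mu>.prob_space by simp
  have \<alpha>_pos: "0 < measure \<alpha> UNIV" using a_pos measure_\<alpha> by simp
  have sin_iff: "symmetric_measure (mean_distribution M \<phi>) \<longleftrightarrow> (\<forall>t>0. sin (?\<theta> t) = 0)"
    using symmetric_measure_iff_gamma_mixture [OF \<mu>.finite_measure_axioms sets_mean_distribution \<mu>_pos a_pos]
    by (simp add: mean_sine_transform)
  show ?thesis
  proof
    assume "symmetric_measure \<alpha>"
    then show "symmetric_measure (mean_distribution M \<phi>)"
      unfolding sin_iff using symmetric_measure_arctan [OF sets_\<alpha>] by simp
  next
    assume "symmetric_measure (mean_distribution M \<phi>)"
    then have sin0: "\<And>t. 0 < t \<Longrightarrow> sin (?\<theta> t) = 0" unfolding sin_iff by blast
    have cont: "continuous_on UNIV ?\<theta>"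
      by (rule continuous_integral_arctan [OF \<alpha>.finite_measure_axioms sets_\<alpha>])
    have "?\<theta> t = 0" if t: "0 < t" for t
    proof (rule ccontr)
      \<comment> \<open>A nonzero value of \<open>\<theta>\<close> is a multiple of \<open>pi\<close>, so \<open>\<theta>\<close> would take an intermediate value of
        modulus 1, where the sine is positive.\<close>
      assume nz: "?\<theta> t \<noteq> 0"
      have "pi \<le> \<bar>?\<theta> t\<bar>"
      proof (rule ccontr)
        assume "\<not> pi \<le> \<bar>?\<theta> t\<bar>"
        then have "sin \<bar>?\<theta> t\<bar> > 0" using nz by (intro sin_gt_zero) auto
        then show False using sin0 [OF t] by (auto simp: abs_if split: if_splits)
      qed
      then have "1 \<le> \<bar>?\<theta> t\<bar>" using pi_gt3 by linarith
      moreover have "\<bar>?\<theta> 0\<bar> \<le> 1" by simp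
      moreover have "continuous_on {0..t} (\<lambda>t. \<bar>?\<theta> t\<bar>)"
        using cont by (intro continuous_intros) (auto intro: continuous_on_subset)
      ultimately obtain r where r: "0 \<le> r" "\<bar>?\<theta> r\<bar> = 1"
        using IVT' [of "\<lambda>t. \<bar>?\<theta> t\<bar>" 0 1 t] t by auto
      then have "0 < r" by (cases "r = 0") auto
      then have "sin (?\<theta> r) = 0" by (rule sin0)
      then have "sin \<bar>?\<theta> r\<bar> = 0" by (simp add: abs_if)
      moreover have "0 < sin (1::real)" using pi_gt3 by (intro sin_gt_zero) auto
      ultimately show False using r(2) by simp
    qed
    then show "symmetric_measure \<alpha>"
      by (rule integral_arctan_zero_imp_symmetric [OF \<alpha>.finite_measure_axioms sets_\<alpha> \<alpha>_pos])
  qed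
qed

end
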